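(* The Grothendieck property of ideals is not downward closed in the Katětov order nor in the Rudin–Keisler order. That is: there are ideals $\mathcal I,\mathcal J$ on $\omega$ with $\mathcal I\le_K\mathcal J$ such that $\mathcal J$ is Grothendieck and $\mathcal I$ is not; and there are ideals $\mathcal I,\mathcal J$ on $\omega$ with $\mathcal I\le_{RK}\mathcal J$ such that $\mathcal J$ is Grothendieck and $\mathcal I$ is not.
   Context: All ideals on $\omega$ are proper and contain all finite sets. For ideals $\mathcal I,\mathcal J$ on $\omega$: $\mathcal I\le_K\mathcal J$ (Katětov order) if there is $f:\omega\to\omega$ with $f^{-1}(A)\in\mathcal J$ for every $A\in\mathcal I$; $\mathcal I\le_{RK}\mathcal J$ (Rudin–Keisler order) if there is $f:\omega\to\omega$ such that for every $A\subseteq\omega$, $A\in\mathcal I$ if and only if $f^{-1}(A)\in\mathcal J$. An ideal $\mathcal I$ is Grothendieck if the Banach space $c_{0,\mathcal I}=\{(x_n)\in\ell_\infty:\ \forall\epsilon>0\ \{n:|x_n|\ge\epsilon\}\in\mathcal I\}$ (supremum norm) is Grothendieck, i.e. every weak$^*$ null sequence in its dual is weakly null. *)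

theory Defs
  imports "HOL-Analysis.Analysis"
begin

section \<open>Ideals on the natural numbers\<close>

definition omega_ideal :: "nat set set \<Rightarrow> bool" where
  "omega_ideal I \<longleftrightarrow>
     (\<forall>A. finite A \<longrightarrow> A \<in> I) \<and>
     (\<forall>A B. A \<in> I \<longrightarrow> B \<subseteq> A \<longrightarrow> B \<in> I) \<and>
     (\<forall>A B. A \<in> I \<longrightarrow> B \<in> I \<longrightarrow> A \<union> B \<in> I) \<and>
     UNIV \<notin> I"

definition katetov_le :: "nat set set \<Rightarrow> nat set set \<Rightarrow> bool" where
  "katetov_le I J \<longleftrightarrow> (\<exists>f :: nat \<Rightarrow> nat. \<forall>A\<in>I. f -` A \<in> J)"

definition rudin_keisler_le :: "nat set set \<Rightarrow> nat set set \<Rightarrow> bool" where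
  "rudin_keisler_le I J \<longleftrightarrow> (\<exists>f :: nat \<Rightarrow> nat. \<forall>A. A \<in> I \<longleftrightarrow> f -` A \<in> J)"


section \<open>Dual and bidual of a linear subspace\<close>

text \<open>
  A normed space that depends on a parameter is represented by a linear subspace \<open>X\<close> of a fixed
  ambient normed space, with the inherited norm.  A functional on \<open>X\<close> is a function on the ambient
  type that is normalized to vanish outside \<open>X\<close>, so that functionals agreeing on \<open>X\<close> are equal and
  the vector space operations of the dual are pointwise.  The dual is that of \<open>X\<close> itself: no
  extension to the ambient space is assumed.
\<close>

definition dual_on :: "'a::real_normed_vector set \<Rightarrow> ('a \<Rightarrow> real) set" where
  "dual_on X = {f.
     (\<forall>x\<in>X. \<forall>y\<in>X. f (x + y) = f x + f y) \<and>
     (\<forall>x\<in>X. \<forall>c. f (c *\<^sub>R x) = c * f x) \<and>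
     (\<exists>K. \<forall>x\<in>X. \<bar>f x\<bar> \<le> K * norm x) \<and>
     (\<forall>x. x \<notin> X \<longrightarrow> f x = 0)}"

definition dual_norm_on :: "'a::real_normed_vector set \<Rightarrow> ('a \<Rightarrow> real) \<Rightarrow> real" where
  "dual_norm_on X f = (SUP x\<in>{x \<in> X. norm x \<le> 1}. \<bar>f x\<bar>)"

definition bidual_on :: "'a::real_normed_vector set \<Rightarrow> (('a \<Rightarrow> real) \<Rightarrow> real) set" where
  "bidual_on X = {\<Phi>.
     (\<forall>f\<in>dual_on X. \<forall>g\<in>dual_on X. \<Phi> (\<lambda>x. f x + g x) = \<Phi> f + \<Phi> g) \<and>
     (\<forall>f\<in>dual_on X. \<forall>c. \<Phi> (\<lambda>x. c * f x) = c * \<Phi> f) \<and>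
     (\<exists>K. \<forall>f\<in>dual_on X. \<bar>\<Phi> f\<bar> \<le> K * dual_norm_on X f) \<and>
     (\<forall>f. f \<notin> dual_on X \<longrightarrow> \<Phi> f = 0)}"


section \<open>The Grothendieck property\<close>

definition weak_star_null_on :: "'a::real_normed_vector set \<Rightarrow> (nat \<Rightarrow> 'a \<Rightarrow> real) \<Rightarrow> bool" where
  "weak_star_null_on X \<phi> \<longleftrightarrow> (\<forall>x\<in>X. (\<lambda>n. \<phi> n x) \<longlonglongrightarrow> 0)"

definition weakly_null_dual_on :: "'a::real_normed_vector set \<Rightarrow> (nat \<Rightarrow> 'a \<Rightarrow> real) \<Rightarrow> bool" where
  "weakly_null_dual_on X \<phi> \<longleftrightarrow> (\<forall>\<Phi>\<in>bidual_on X. (\<lambda>n. \<Phi> (\<phi> n)) \<longlonglongrightarrow> 0)"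

definition grothendieck_on :: "'a::real_normed_vector set \<Rightarrow> bool" where
  "grothendieck_on X \<longleftrightarrow>
     (\<forall>\<phi>. (\<forall>n. \<phi> n \<in> dual_on X) \<longrightarrow> weak_star_null_on X \<phi> \<longrightarrow> weakly_null_dual_on X \<phi>)"

text \<open>
  Since \<^typ>\<open>nat\<close> carries the discrete topology, \<^typ>\<open>nat \<Rightarrow>\<^sub>C real\<close> is the space of all bounded real
  sequences with the supremum norm.
\<close>

definition c0_ideal :: "nat set set \<Rightarrow> (nat \<Rightarrow>\<^sub>C real) set" where
  "c0_ideal I = {x. \<forall>\<epsilon>>0. {n. \<bar>apply_bcontfun x n\<bar> \<ge> \<epsilon>} \<in> I}"

definition grothendieck_ideal :: "nat set set \<Rightarrow> bool" where
  "grothendieck_ideal I \<longleftrightarrow> grothendieck_on (c0_ideal I)"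


section \<open>The space associated with an ideal is a Banach space\<close>

lemma c0_idealD: "x \<in> c0_ideal I \<Longrightarrow> \<epsilon> > 0 \<Longrightarrow> {n. \<bar>apply_bcontfun x n\<bar> \<ge> \<epsilon>} \<in> I"
  by (simp add: c0_ideal_def)

lemma subspace_c0_ideal:
  assumes "omega_ideal I"
  shows "subspace (c0_ideal I)"
proof (rule subspaceI)
  show "0 \<in> c0_ideal I"
    using assms by (auto simp: c0_ideal_def omega_ideal_def)
next
  fix x y assume xy: "x \<in> c0_ideal I" "y \<in> c0_ideal I"
  show "x + y \<in> c0_ideal I"
    unfolding c0_ideal_def
  proof (intro CollectI allI impI)
    fix e :: real assume "e > 0"
    then have "{n. \<bar>apply_bcontfun x n\<bar> \<ge> e/2} \<union> {n. \<bar>apply_bcontfun y n\<bar> \<ge> e/2} \<in> I"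
      using c0_idealD[OF xy(1), of "e/2"] c0_idealD[OF xy(2), of "e/2"] assms
      unfolding omega_ideal_def by (meson half_gt_zero)
    moreover have "{n. \<bar>apply_bcontfun (x + y) n\<bar> \<ge> e} \<subseteq>
        {n. \<bar>apply_bcontfun x n\<bar> \<ge> e/2} \<union> {n. \<bar>apply_bcontfun y n\<bar> \<ge> e/2}"
      unfolding plus_bcontfun.rep_eq by (intro subsetI) (simp, linarith)
    ultimately show "{n. \<bar>apply_bcontfun (x + y) n\<bar> \<ge> e} \<in> I"
      using assms unfolding omega_ideal_def by blast
  qed
next
  fix c x assume x: "x \<in> c0_ideal I"
  show "c *\<^sub>R x \<in> c0_ideal I"
    unfolding c0_ideal_def
  proof (intro CollectI allI impI)
    fix e :: real assume e: "e > 0"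
    show "{n. \<bar>apply_bcontfun (c *\<^sub>R x) n\<bar> \<ge> e} \<in> I"
    proof (cases "c = 0")
      case True
      then show ?thesis using e assms by (simp add: omega_ideal_def)
    next
      case False
      then have "{n. \<bar>apply_bcontfun (c *\<^sub>R x) n\<bar> \<ge> e} = {n. \<bar>apply_bcontfun x n\<bar> \<ge> e / \<bar>c\<bar>}"
        by (auto simp: scaleR_bcontfun.rep_eq abs_mult field_simps)
      then show ?thesis using x e False by (simp add: c0_ideal_def)
    qed
  qed
qed

lemma closed_c0_ideal:
  assumes "omega_ideal I"
  shows "closed (c0_ideal I)"
  unfolding closed_sequential_limits
proof (intro allI impI, elim conjE)
  fix x l assume x: "\<forall>n. x n \<in> c0_ideal I" and lim: "x \<longlonglongrightarrow> l"
  show "l \<in> c0_ideal I"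
    unfolding c0_ideal_def
  proof (intro CollectI allI impI)
    fix e :: real assume "e > 0"
    then obtain m where m: "dist (x m) l < e/2"
      using lim unfolding lim_sequentially by (meson half_gt_zero order_refl)
    have "\<bar>apply_bcontfun (x m) n\<bar> \<ge> e/2" if "\<bar>apply_bcontfun l n\<bar> \<ge> e" for n
      using that m dist_bounded[of "x m" n l] unfolding dist_real_def by linarith
    then have "{n. \<bar>apply_bcontfun l n\<bar> \<ge> e} \<subseteq> {n. \<bar>apply_bcontfun (x m) n\<bar> \<ge> e/2}"
      by blast
    moreover have "{n. \<bar>apply_bcontfun (x m) n\<bar> \<ge> e/2} \<in> I"
      using c0_idealD[OF x[rule_format]] \<open>e > 0\<close> half_gt_zero by blast
    ultimately show "{n. \<bar>apply_bcontfun l n\<bar> \<ge> e} \<in> I"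
      using assms unfolding omega_ideal_def by blast
  qed
qed

end

theory Submission
  imports Defs
begin

text \<open>
  Both parts are witnessed by the same pair: the ideal of finite sets and a density ideal built from
  pathological submeasures.  Split \<open>\<omega>\<close> into finite fibres, the \<open>n\<close>-th one being a copy of the
  family of \<open>n\<close>-element subsets of \<open>{..<2 * n}\<close>, and let \<open>cover_ideal\<close> consist of the sets such that
  the members of their trace on the \<open>n\<close>-th fibre are all met by some set of \<open>o(n)\<close> points.  More
  than \<open>n\<close> points are needed for a whole fibre, so a union of fibres is in the ideal iff it consists of finitely many of them: the map
  sending each point to the index of its fibre shows that the finite sets lie Rudin--Keisler below,
  hence Katetov below, \<open>cover_ideal\<close>.  The space of the finite sets is \<open>c\<^sub>0\<close>, where the coordinate
  functionals are weak* null and not weakly null (\<open>not_grothendieck_finite_sets\<close>).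

  It remains to see that \<open>cover_ideal\<close> is Grothendieck.  Functionals on \<^term>\<open>c0_ideal J\<close> act as
  finitely additive measures on \<open>J\<close>, and the proof has two halves.

  For every \<open>J\<close>, a weak* null sequence is weakly null as soon as it is uniformly exhaustive on
  disjoint sequences in \<open>J\<close> (\<open>exhaustive_imp_grothendieck_ideal\<close>).  A bidual element that stays
  positive along the sequence yields, by Helly's theorem
  (\<open>bidual_on_positive_imp_common_positive\<close>), a bounded sequence of points on which more and
  more of the functionals are uniformly positive.  Choosing these points of almost minimal
  \<open>L\<^sup>2\<close>-norm for a control measure makes them converge in mean, so differences of them are large
  only on small sets, on which the functionals nevertheless keep a fixed variation.  Exhaustiveness
  implies uniform absolute continuity and rules this out (\<open>no_concentration\<close>).

  For \<open>cover_ideal\<close>, weak* null sequences are uniformly exhaustive (\<open>uniformly_exhaustive\<close>).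
  Phillips's lemma (\<open>phillips\<close>) gives this for disjoint sets whose union is in the ideal.  As
  \<open>cover_ideal\<close> is a P-ideal, disjoint sets in it become so after a finite part of each is
  removed.  For the finite parts the pathology is used: each measure on a fibre keeps half of its
  mass on the sets through a single point, and a union of such pieces over disjoint ranges of fibres
  is again in the ideal (\<open>finite_support_tendsto_zero\<close>).
\<close>

section \<open>Bounded functionals and their absolute values\<close>

text \<open>The elements of \<^term>\<open>c0_ideal J\<close> as plain functions, so that truncations, squares and
  pointwise sums of infinitely many functions with disjoint supports are at hand.\<close>

definition null_fun :: "nat set set \<Rightarrow> (nat \<Rightarrow> real) set" where
  "null_fun J = {f. bounded (range f) \<and> (\<forall>e>0. {n. e \<le> \<bar>f n\<bar>} \<in> J)}"

lemma omega_ideal_finite: "omega_ideal J \<Longrightarrow> finite A \<Longrightarrow> A \<in> J"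
  and omega_ideal_subset: "omega_ideal J \<Longrightarrow> B \<in> J \<Longrightarrow> A \<subseteq> B \<Longrightarrow> A \<in> J"
  and omega_ideal_Un: "omega_ideal J \<Longrightarrow> A \<in> J \<Longrightarrow> B \<in> J \<Longrightarrow> A \<union> B \<in> J"
  unfolding omega_ideal_def by blast+

lemma omega_ideal_UN:
  assumes "omega_ideal J" "finite I" "\<And>i. i \<in> I \<Longrightarrow> A i \<in> J"
  shows "(\<Union>i\<in>I. A i) \<in> J"
  using assms(2,3)
proof (induction I rule: finite_induct)
  case empty
  then show ?case using omega_ideal_finite[OF assms(1)] by simp
next
  case (insert i I)
  then show ?case using omega_ideal_Un[OF assms(1)] by simp
qed

lemma null_fun_bound:
  assumes "f \<in> null_fun J"
  obtains B where "B > 0" "\<And>n. \<bar>f n\<bar> \<le> B"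
  using assms unfolding null_fun_def bounded_pos by auto

lemma null_fun_solid:
  assumes "omega_ideal J" "g \<in> null_fun J" "\<And>n. \<bar>f n\<bar> \<le> \<bar>g n\<bar>"
  shows "f \<in> null_fun J"
proof -
  obtain B where B: "\<And>n. \<bar>g n\<bar> \<le> B"
    using assms(2) null_fun_bound by blast
  have "bounded (range f)"
    unfolding bounded_iff using B assms(3) by (auto intro!: exI[of _ B] order_trans[OF assms(3)])
  moreover have "{n. e \<le> \<bar>f n\<bar>} \<in> J" if "e > 0" for e
  proof (rule omega_ideal_subset[OF assms(1)])
    show "{n. e \<le> \<bar>g n\<bar>} \<in> J" using assms(2) that by (simp add: null_fun_def)
    show "{n. e \<le> \<bar>f n\<bar>} \<subseteq> {n. e \<le> \<bar>g n\<bar>}" using assms(3) by (auto intro: order_trans)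
  qed
  ultimately show ?thesis by (simp add: null_fun_def)
qed

lemma null_fun_scale:
  assumes "omega_ideal J" "f \<in> null_fun J"
  shows "(\<lambda>n. c * f n) \<in> null_fun J"
proof -
  obtain B where B: "\<And>n. \<bar>f n\<bar> \<le> B"
    using assms(2) null_fun_bound by blast
  have "bounded (range (\<lambda>n. c * f n))"
    unfolding bounded_iff using B by (auto intro!: exI[of _ "\<bar>c\<bar> * B"] mult_left_mono simp: abs_mult)
  moreover have "{n. e \<le> \<bar>c * f n\<bar>} \<in> J" if "e > 0" for e
  proof (cases "c = 0")
    case True
    then show ?thesis using that omega_ideal_finite[OF assms(1)] by simp
  next
    case False
    then have "{n. e \<le> \<bar>c * f n\<bar>} = {n. e / \<bar>c\<bar> \<le> \<bar>f n\<bar>}"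
      by (auto simp: abs_mult field_simps)
    then show ?thesis using assms(2) that False by (simp add: null_fun_def)
  qed
  ultimately show ?thesis by (simp add: null_fun_def)
qed

lemma null_fun_add:
  assumes "omega_ideal J" "f \<in> null_fun J" "g \<in> null_fun J"
  shows "(\<lambda>n. f n + g n) \<in> null_fun J"
proof -
  have "bounded (range (\<lambda>n. f n + g n))"
    using assms(2,3) by (auto simp: null_fun_def intro: bounded_plus_comp)
  moreover have "{n. e \<le> \<bar>f n + g n\<bar>} \<in> J" if "e > 0" for e
  proof (rule omega_ideal_subset[OF assms(1)])
    show "{n. e/2 \<le> \<bar>f n\<bar>} \<union> {n. e/2 \<le> \<bar>g n\<bar>} \<in> J"
      using assms that half_gt_zero[OF that] unfolding null_fun_def
      by (intro omega_ideal_Un) blast+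
    show "{n. e \<le> \<bar>f n + g n\<bar>} \<subseteq> {n. e/2 \<le> \<bar>f n\<bar>} \<union> {n. e/2 \<le> \<bar>g n\<bar>}"
    proof
      fix n assume "n \<in> {n. e \<le> \<bar>f n + g n\<bar>}"
      then have "e/2 \<le> \<bar>f n\<bar> \<or> e/2 \<le> \<bar>g n\<bar>" by (simp, linarith)
      then show "n \<in> {n. e/2 \<le> \<bar>f n\<bar>} \<union> {n. e/2 \<le> \<bar>g n\<bar>}" by blast
    qed
  qed
  ultimately show ?thesis by (simp add: null_fun_def)
qed

lemma null_fun_diff:
  assumes "omega_ideal J" "f \<in> null_fun J" "g \<in> null_fun J"
  shows "(\<lambda>n. f n - g n) \<in> null_fun J"
  using null_fun_add[OF assms(1,2) null_fun_scale[OF assms(1,3), of "-1"]] by simp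

lemma null_fun_square:
  assumes "omega_ideal J" "f \<in> null_fun J"
  shows "(\<lambda>n. (f n)\<^sup>2) \<in> null_fun J"
proof -
  obtain B where B: "\<And>n. \<bar>f n\<bar> \<le> B" "B > 0"
    using assms(2) null_fun_bound by blast
  show ?thesis
  proof (rule null_fun_solid[OF assms(1) null_fun_scale[OF assms, of B]])
    show "\<bar>(f n)\<^sup>2\<bar> \<le> \<bar>B * f n\<bar>" for n
      using mult_right_mono[OF B(1)[of n], of "\<bar>f n\<bar>"] B(2) by (simp add: abs_mult power2_eq_square)
  qed
qed

lemma null_fun_indicator:
  assumes "omega_ideal J"
  shows "indicator A \<in> null_fun J \<longleftrightarrow> A \<in> J"
proof
  assume "indicator A \<in> null_fun J"
  then have "{n. 1 \<le> \<bar>indicator A n :: real\<bar>} \<in> J" by (simp add: null_fun_def)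
  moreover have "{n. 1 \<le> \<bar>indicator A n :: real\<bar>} = A" by (auto simp: indicator_def)
  ultimately show "A \<in> J" by simp
next
  assume A: "A \<in> J"
  have "bounded (range (indicator A :: nat \<Rightarrow> real))"
    unfolding bounded_iff by (auto intro!: exI[of _ 1] simp: indicator_def)
  moreover have "{n. e \<le> \<bar>indicator A n :: real\<bar>} \<in> J" if "e > 0" for e
    by (rule omega_ideal_subset[OF assms A]) (use that in \<open>auto simp: indicator_def split: if_splits\<close>)
  ultimately show "indicator A \<in> null_fun J" by (simp add: null_fun_def)
qed

lemma null_fun_support:
  assumes "omega_ideal J" "A \<in> J" "\<And>n. \<bar>f n\<bar> \<le> B * indicator A n"
  shows "f \<in> null_fun J"
proof (rule null_fun_solid[OF assms(1) null_fun_scale[OF assms(1), of "indicator A" "\<bar>B\<bar>"]])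
  show "indicator A \<in> null_fun J" using assms by (simp add: null_fun_indicator)
  show "\<bar>f n\<bar> \<le> \<bar>\<bar>B\<bar> * indicator A n\<bar>" for n
    using assms(3)[of n] by (auto simp: indicator_def)
qed

text \<open>The supremum over all \<open>f\<close> dominated by \<open>g\<close> is the value at \<open>g \<ge> 0\<close> of the absolute value of
  \<open>p\<close> in the Banach lattice dual; at \<open>indicator A\<close> it is the total variation of the finitely
  additive measure \<open>p\<close> on \<open>A\<close>.\<close>

definition absval :: "((nat \<Rightarrow> real) \<Rightarrow> real) \<Rightarrow> (nat \<Rightarrow> real) \<Rightarrow> real" where
  "absval p g = (SUP f\<in>{f. \<forall>n. \<bar>f n\<bar> \<le> g n}. p f)"

locale bdd_functional =
  fixes J :: "nat set set" and R :: real and p :: "(nat \<Rightarrow> real) \<Rightarrow> real"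
  assumes ideal: "omega_ideal J"
    and add: "\<And>f g. f \<in> null_fun J \<Longrightarrow> g \<in> null_fun J \<Longrightarrow> p (\<lambda>n. f n + g n) = p f + p g"
    and scale: "\<And>f c. f \<in> null_fun J \<Longrightarrow> p (\<lambda>n. c * f n) = c * p f"
    and bound: "\<And>f B. f \<in> null_fun J \<Longrightarrow> (\<And>n. \<bar>f n\<bar> \<le> B) \<Longrightarrow> \<bar>p f\<bar> \<le> R * B"
begin

lemma zero_mem: "(\<lambda>n. 0) \<in> null_fun J"
  using null_fun_support[OF ideal omega_ideal_finite[OF ideal finite.emptyI], of "\<lambda>n. 0"] by simp

lemma zero: "p (\<lambda>n. 0) = 0"
  using scale[OF zero_mem, of 0] by simp

lemma R_nonneg: "0 \<le> R"
  using bound[OF zero_mem, of 1] zero by simp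

lemma diff: "f \<in> null_fun J \<Longrightarrow> g \<in> null_fun J \<Longrightarrow> p (\<lambda>n. f n - g n) = p f - p g"
  using add[of f "\<lambda>n. -1 * g n"] null_fun_scale[OF ideal, of g "-1"] scale[of g "-1"] by simp

lemma sum:
  assumes "finite I" "\<And>i. i \<in> I \<Longrightarrow> f i \<in> null_fun J"
  shows "(\<lambda>n. \<Sum>i\<in>I. f i n) \<in> null_fun J \<and> p (\<lambda>n. \<Sum>i\<in>I. f i n) = (\<Sum>i\<in>I. p (f i))"
  using assms
proof (induction I rule: finite_induct)
  case empty
  then show ?case by (simp add: zero_mem zero)
next
  case (insert i I)
  then show ?case using null_fun_add[OF ideal] add by simp
qed

lemma dominated_mem:
  assumes "g \<in> null_fun J" "\<forall>n. \<bar>f n\<bar> \<le> g n"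
  shows "f \<in> null_fun J"
  using null_fun_solid[OF ideal assms(1)] assms(2) by (meson abs_ge_self order_trans)

lemma absval_bdd:
  assumes "g \<in> null_fun J"
  shows "bdd_above (p ` {f. \<forall>n. \<bar>f n\<bar> \<le> g n})"
proof -
  obtain B where B: "\<And>n. \<bar>g n\<bar> \<le> B"
    using assms null_fun_bound by blast
  have "p f \<le> R * B" if "\<forall>n. \<bar>f n\<bar> \<le> g n" for f
    using bound[OF dominated_mem[OF assms that], of B] that B
    by (meson abs_le_D1 abs_ge_self order_trans)
  then show ?thesis by (intro bdd_aboveI[of _ "R * B"]) auto
qed

lemma le_absval:
  assumes "g \<in> null_fun J" "\<And>n. \<bar>f n\<bar> \<le> g n"
  shows "\<bar>p f\<bar> \<le> absval p g"
proof -
  have f: "f \<in> null_fun J" using dominated_mem assms by blast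
  have "p f \<le> absval p g"
    unfolding absval_def by (rule cSUP_upper[OF _ absval_bdd[OF assms(1)]]) (use assms in auto)
  moreover have "p (\<lambda>n. -1 * f n) \<le> absval p g"
    unfolding absval_def by (rule cSUP_upper[OF _ absval_bdd[OF assms(1)]]) (use assms in auto)
  moreover have "p (\<lambda>n. -1 * f n) = - p f" using scale[OF f, of "-1"] by simp
  ultimately show ?thesis by linarith
qed

lemma absval_le:
  assumes "\<And>n. 0 \<le> g n" "\<And>f. (\<And>n. \<bar>f n\<bar> \<le> g n) \<Longrightarrow> p f \<le> c"
  shows "absval p g \<le> c"
  unfolding absval_def by (rule cSUP_least) (use assms in \<open>auto intro: exI[of _ "\<lambda>n. 0"]\<close>)

lemma absval_nonneg: "g \<in> null_fun J \<Longrightarrow> (\<And>n. 0 \<le> g n) \<Longrightarrow> 0 \<le> absval p g"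
  using le_absval[of g "\<lambda>n. 0"] by (simp add: zero)

lemma absval_mono:
  assumes "g \<in> null_fun J" "\<And>n. 0 \<le> h n" "\<And>n. h n \<le> g n"
  shows "absval p h \<le> absval p g"
proof (rule absval_le[OF assms(2)])
  fix f assume "\<And>n. \<bar>f n\<bar> \<le> h n"
  then have "\<bar>p f\<bar> \<le> absval p g" using assms by (intro le_absval) (auto intro: order_trans)
  then show "p f \<le> absval p g" by simp
qed

lemma absval_le_bound:
  assumes "g \<in> null_fun J" "\<And>n. 0 \<le> g n" "\<And>n. g n \<le> B"
  shows "absval p g \<le> R * B"
proof (rule absval_le[OF assms(2)])
  fix f assume f: "\<And>n. \<bar>f n\<bar> \<le> g n"
  have "\<bar>p f\<bar> \<le> R * B"
    using bound[of f B] dominated_mem[OF assms(1)] f assms(3) by (meson order_trans)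
  then show "p f \<le> R * B" by simp
qed

lemma absval_approx:
  assumes "\<And>n. 0 \<le> g n" "c < absval p g"
  obtains f where "\<And>n. \<bar>f n\<bar> \<le> g n" "c < p f"
  using absval_le[of g c] assms by (meson not_le)

text \<open>Additivity on the positive cone is the Riesz decomposition property: a function dominated by
  \<open>g + h\<close> is split by truncating it at \<open>g\<close>.\<close>

lemma absval_add:
  assumes g: "g \<in> null_fun J" "\<And>n. 0 \<le> g n" and h: "h \<in> null_fun J" "\<And>n. 0 \<le> h n"
  shows "absval p (\<lambda>n. g n + h n) = absval p g + absval p h"
proof (rule antisym)
  have gh: "(\<lambda>n. g n + h n) \<in> null_fun J" using null_fun_add[OF ideal g(1) h(1)] .
  show "absval p (\<lambda>n. g n + h n) \<le> absval p g + absval p h"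
  proof (rule absval_le)
    show "0 \<le> g n + h n" for n using g h by simp
    fix f assume f: "\<And>n. \<bar>f n\<bar> \<le> g n + h n"
    define u where "u n = max (- g n) (min (f n) (g n))" for n
    have u: "\<bar>u n\<bar> \<le> g n" for n using g(2)[of n] unfolding u_def by (auto simp: max_def min_def)
    have v: "\<bar>f n - u n\<bar> \<le> h n" for n
      using f[of n] g(2)[of n] h(2)[of n] unfolding u_def by (auto simp: max_def min_def abs_if split: if_splits)
    have "p f = p (\<lambda>n. u n + (f n - u n))" by simp
    also have "\<dots> = p u + p (\<lambda>n. f n - u n)"
      using dominated_mem[OF g(1), of u] dominated_mem[OF h(1), of "\<lambda>n. f n - u n"] u v
      by (intro add) blast+
    also have "\<dots> \<le> absval p g + absval p h"
      using le_absval[OF g(1), of u] le_absval[OF h(1), of "\<lambda>n. f n - u n"] u v by fastforce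
    finally show "p f \<le> absval p g + absval p h" .
  qed
  have "absval p g + absval p h \<le> absval p (\<lambda>n. g n + h n) + e" if e: "e > 0" for e
  proof -
    obtain a where a: "\<And>n. \<bar>a n\<bar> \<le> g n" "absval p g - e/2 < p a"
      using absval_approx[of g "absval p g - e/2"] g(2) e by auto
    obtain b where b: "\<And>n. \<bar>b n\<bar> \<le> h n" "absval p h - e/2 < p b"
      using absval_approx[of h "absval p h - e/2"] h(2) e by auto
    have "p a + p b = p (\<lambda>n. a n + b n)"
      using dominated_mem[OF g(1), of a] dominated_mem[OF h(1), of b] a b
      by (intro add[symmetric]) blast+
    also have "\<bar>\<dots>\<bar> \<le> absval p (\<lambda>n. g n + h n)"
      using a b by (intro le_absval[OF gh]) (meson abs_triangle_ineq add_mono order_trans)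
    finally show ?thesis using a(2) b(2) by linarith
  qed
  then show "absval p g + absval p h \<le> absval p (\<lambda>n. g n + h n)"
    by (rule field_le_epsilon)
qed

lemma absval_scale_le:
  assumes "g \<in> null_fun J" "\<And>n. 0 \<le> g n" "0 < c"
  shows "absval p (\<lambda>n. c * g n) \<le> c * absval p g"
proof (rule absval_le)
  show "0 \<le> c * g n" for n using assms by simp
  fix f assume f: "\<And>n. \<bar>f n\<bar> \<le> c * g n"
  have fm: "f \<in> null_fun J" using dominated_mem[OF null_fun_scale[OF ideal assms(1)]] f by blast
  have "\<bar>p (\<lambda>n. (1/c) * f n)\<bar> \<le> absval p g"
    using f assms(3) by (intro le_absval[OF assms(1)]) (simp add: abs_mult field_simps)
  also have "p (\<lambda>n. (1/c) * f n) = (1/c) * p f" by (rule scale[OF fm])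
  finally show "p f \<le> c * absval p g" using assms(3) by (simp add: abs_mult field_simps)
qed

abbreviation variation :: "nat set \<Rightarrow> real" where
  "variation A \<equiv> absval p (indicator A)"

lemma variation_nonneg: "A \<in> J \<Longrightarrow> 0 \<le> variation A"
  by (rule absval_nonneg) (simp_all add: null_fun_indicator[OF ideal])

lemma variation_mono: "B \<in> J \<Longrightarrow> A \<subseteq> B \<Longrightarrow> variation A \<le> variation B"
  by (rule absval_mono) (auto simp: null_fun_indicator[OF ideal] indicator_def)

lemma variation_le: "A \<in> J \<Longrightarrow> variation A \<le> R"
  using absval_le_bound[of "indicator A" 1] by (simp add: null_fun_indicator[OF ideal] indicator_def)

lemma variation_disjoint_Un:
  assumes "A \<in> J" "B \<in> J" "A \<inter> B = {}"
  shows "variation (A \<union> B) = variation A + variation B"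
proof -
  have "(indicator (A \<union> B) :: nat \<Rightarrow> real) = (\<lambda>n. indicator A n + indicator B n)"
    using assms(3) by (auto simp: indicator_def fun_eq_iff)
  then show ?thesis
    using absval_add[of "indicator A" "indicator B"] assms by (simp add: null_fun_indicator[OF ideal])
qed

lemma variation_Un_le:
  assumes "A \<in> J" "B \<in> J"
  shows "variation (A \<union> B) \<le> variation A + variation B"
proof -
  have "B - A \<in> J" using assms omega_ideal_subset[OF ideal] by blast
  then have "variation (A \<union> (B - A)) = variation A + variation (B - A)"
    using assms by (intro variation_disjoint_Un) auto
  then show ?thesis using variation_mono[OF assms(2), of "B - A"] by simp
qed

lemma variation_UN_le:
  assumes "finite I" "\<And>i. i \<in> I \<Longrightarrow> A i \<in> J"
  shows "variation (\<Union>i\<in>I. A i) \<le> (\<Sum>i\<in>I. variation (A i))"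
  using assms
proof (induction I rule: finite_induct)
  case empty
  have "absval p (\<lambda>n. 0) \<le> R * 0"
    by (rule absval_le_bound) (simp_all add: zero_mem)
  moreover have "(indicator {} :: nat \<Rightarrow> real) = (\<lambda>n. 0)" by auto
  ultimately show ?case by simp
next
  case (insert i I)
  then show ?case
    using variation_Un_le[of "A i" "\<Union>i\<in>I. A i"] omega_ideal_UN[OF ideal, of I A] by simp
qed

lemma variation_disjoint_sum_le:
  assumes "finite I" "\<And>i. i \<in> I \<Longrightarrow> A i \<in> J" "disjoint_family_on A I"
  shows "(\<Sum>i\<in>I. variation (A i)) \<le> R"
proof -
  have U: "(\<Union>i\<in>I. A i) \<in> J" using assms omega_ideal_UN[OF ideal] by blast
  have "(\<Sum>i\<in>I. variation (A i)) \<le> variation (\<Union>i\<in>I. A i)"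
    using assms
  proof (induction I rule: finite_induct)
    case empty
    have "0 \<le> variation {}" using omega_ideal_finite[OF ideal] by (intro variation_nonneg) simp
    then show ?case by (simp only: sum.empty UN_empty)
  next
    case (insert i I)
    have d: "A i \<inter> (\<Union>i\<in>I. A i) = {}"
      using insert.prems(2) insert.hyps(2) by (auto simp: disjoint_family_on_def)
    have "(\<Sum>i\<in>I. variation (A i)) \<le> variation (\<Union>i\<in>I. A i)"
      using insert by (intro insert.IH) (auto simp: disjoint_family_on_def)
    moreover have "variation (A i \<union> (\<Union>i\<in>I. A i)) = variation (A i) + variation (\<Union>i\<in>I. A i)"
      using insert omega_ideal_UN[OF ideal, of I A] by (intro variation_disjoint_Un[OF _ _ d]) auto
    ultimately show ?case using insert.hyps by simp
  qed
  then show ?thesis using variation_le[OF U] by simp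
qed

end

section \<open>Phillips's lemma\<close>

lemma not_tendsto_zero_real:
  fixes a :: "nat \<Rightarrow> real"
  assumes "\<not> a \<longlonglongrightarrow> 0"
  obtains d where "d > 0" "infinite {k. d \<le> \<bar>a k\<bar>}"
proof -
  obtain d where d: "d > 0" "\<not> eventually (\<lambda>k. \<bar>a k\<bar> < d) sequentially"
    using assms unfolding tendsto_iff by (auto simp: dist_real_def)
  then have "infinite {k. d \<le> \<bar>a k\<bar>}"
    unfolding not_eventually frequently_sequentially not_less
    by (auto simp: infinite_nat_iff_unbounded_le)
  with d(1) show ?thesis using that by blast
qed

lemma infinite_split:
  assumes "infinite (N :: nat set)"
  obtains A B where "A \<subseteq> N" "B \<subseteq> N" "A \<inter> B = {}" "infinite A" "infinite B"
proof -
  define e where "e = enumerate N"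
  have e: "inj e" "range e = N"
    using assms by (simp_all add: e_def strict_mono_enumerate strict_mono_imp_inj_on range_enumerate)
  define A where "A = range (\<lambda>i. e (2 * i))"
  define B where "B = range (\<lambda>i. e (2 * i + 1))"
  show ?thesis
  proof
    show "A \<subseteq> N" "B \<subseteq> N" using e by (auto simp: A_def B_def)
    show "A \<inter> B = {}" using e(1) unfolding A_def B_def inj_def
      by auto (metis even_mult_iff even_numeral even_Suc)
    have "inj (\<lambda>i. e (2 * i))" "inj (\<lambda>i. e (2 * i + 1))"
      by (intro injI; force dest: injD[OF e(1)])+
    then show "infinite A" "infinite B"
      unfolding A_def B_def using finite_imageD by blast+
  qed
qed

text \<open>Repeated halving.  The map \<open>\<kappa>\<close> sorts the points of \<open>A\<close> into countably many pieces.\<close>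

lemma (in bdd_functional) small_variation_on_infinite_subset:
  assumes "A \<in> J" "infinite (N :: nat set)" "e > 0"
  obtains N' where "N' \<subseteq> N" "infinite N'" "variation (A \<inter> \<kappa> -` N') \<le> e"
proof -
  have sub: "A \<inter> X \<in> J" for X using assms(1) omega_ideal_subset[OF ideal] by blast
  have halving: "\<exists>N'\<subseteq>N. infinite N' \<and> variation (A \<inter> \<kappa> -` N') \<le> R / 2 ^ r" for r
  proof (induction r)
    case 0
    then show ?case using assms(2) variation_le[OF sub] by auto
  next
    case (Suc r)
    then obtain M where M: "M \<subseteq> N" "infinite M" "variation (A \<inter> \<kappa> -` M) \<le> R / 2 ^ r" by blast
    obtain P Q where PQ: "P \<subseteq> M" "Q \<subseteq> M" "P \<inter> Q = {}" "infinite P" "infinite Q"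
      using infinite_split[OF M(2)] by blast
    have "variation (A \<inter> \<kappa> -` P) + variation (A \<inter> \<kappa> -` Q)
        = variation ((A \<inter> \<kappa> -` P) \<union> (A \<inter> \<kappa> -` Q))"
      using PQ(3) by (intro variation_disjoint_Un[symmetric] sub) auto
    also have "\<dots> \<le> variation (A \<inter> \<kappa> -` M)"
      using PQ by (intro variation_mono sub) auto
    finally have le: "variation (A \<inter> \<kappa> -` P) + variation (A \<inter> \<kappa> -` Q) \<le> variation (A \<inter> \<kappa> -` M)" .
    have "variation (A \<inter> \<kappa> -` P) \<le> R / 2 ^ Suc r \<or> variation (A \<inter> \<kappa> -` Q) \<le> R / 2 ^ Suc r"
    proof -
      define c where "c = R / 2 ^ r"
      have half: "R / 2 ^ Suc r = c / 2" by (simp add: c_def)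
      show ?thesis using M(3) le unfolding half c_def[symmetric] by auto
    qed
    then show ?case using PQ M(1) by blast
  qed
  obtain r where "R / e < 2 ^ r" using real_arch_pow[of 2 "R / e"] by auto
  then have "R / 2 ^ r \<le> e" using assms(3) by (simp add: field_simps)
  with halving[of r] show ?thesis using that by (meson order_trans)
qed

locale bdd_functional_seq =
  fixes J :: "nat set set" and R :: real and p :: "nat \<Rightarrow> (nat \<Rightarrow> real) \<Rightarrow> real"
  assumes bdd: "\<And>k. bdd_functional J R (p k)"
    and null: "\<And>f. f \<in> null_fun J \<Longrightarrow> (\<lambda>k. p k f) \<longlonglongrightarrow> 0"
begin

sublocale bdd_functional J R "p k" for k by (rule bdd)

lemma subseq:
  assumes "strict_mono (r :: nat \<Rightarrow> nat)"
  shows "bdd_functional_seq J R (\<lambda>k. p (r k))"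
proof (rule bdd_functional_seq.intro)
  show "bdd_functional J R (p (r k))" for k by (rule bdd)
  show "(\<lambda>k. p (r k) f) \<longlonglongrightarrow> 0" if "f \<in> null_fun J" for f
    using LIMSEQ_subseq_LIMSEQ[OF null[OF that] assms] by (simp add: o_def)
qed

text \<open>A gliding hump.  If the conclusion fails, choose indices \<open>k\<^sub>0 < k\<^sub>1 < \<dots>\<close> and shrinking
  infinite sets of admissible later indices.  The limit \<open>0\<close> at \<open>f k\<close> makes the contribution
  of the earlier terms small; finite additivity leaves an infinite set of later indices on which the
  current variation is small.  At the sum of the chosen \<open>f k\<close>, which is a null function because its
  support lies in \<open>A\<close>, the functionals then stay away from \<open>0\<close>.\<close>

lemma phillips:
  assumes A: "A \<in> J" and f: "\<And>k x. \<bar>f k x\<bar> \<le> indicator A x"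
    and disj: "\<And>j k x. f j x \<noteq> 0 \<Longrightarrow> f k x \<noteq> 0 \<Longrightarrow> j = k"
  shows "(\<lambda>k. p k (f k)) \<longlonglongrightarrow> 0"
proof (rule ccontr)
  assume "\<not> ?thesis"
  then obtain d where d: "d > 0" and inf: "infinite {k. d \<le> \<bar>p k (f k)\<bar>}"
    by (rule not_tendsto_zero_real)
  define K0 where "K0 = {k. d \<le> \<bar>p k (f k)\<bar>}"
  have K0: "infinite K0" using inf by (simp add: K0_def)
  define \<kappa> where "\<kappa> x = (SOME k. f k x \<noteq> 0)" for x
  have \<kappa>: "\<kappa> x = k" if "f k x \<noteq> 0" for k x
    unfolding \<kappa>_def using someI[of "\<lambda>k. f k x \<noteq> 0"] disj that by blast
  define F where "F N x = (if \<kappa> x \<in> N then f (\<kappa> x) x else 0)" for N x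
  have F_le: "\<bar>F N x\<bar> \<le> indicator (A \<inter> \<kappa> -` N) x" for N x
    using f[of "\<kappa> x" x] by (auto simp: F_def indicator_def)
  have sub: "A \<inter> X \<in> J" for X using A omega_ideal_subset[OF ideal] by blast
  have F_mem: "F N \<in> null_fun J" for N
    by (rule null_fun_support[OF ideal sub, of _ 1]) (use F_le in simp)
  have F_single: "F {k} = f k" for k
    using \<kappa> by (fastforce simp: F_def fun_eq_iff)
  have F_Un: "p m (F (M \<union> N)) = p m (F M) + p m (F N)" if "M \<inter> N = {}" for m M N
  proof -
    have "F (M \<union> N) = (\<lambda>x. F M x + F N x)" using that by (auto simp: F_def fun_eq_iff)
    then show ?thesis using add[OF F_mem F_mem] by simp
  qed
  have f_mem: "f k \<in> null_fun J" for k using F_mem[of "{k}"] F_single by simp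
  define P where "P i s = (case s of (k, N) \<Rightarrow> k \<in> K0 \<and> infinite N \<and> N \<subseteq> K0 \<and>
      variation k (A \<inter> \<kappa> -` N) \<le> d/4 \<and> (\<forall>m\<in>N. k < m \<and> \<bar>p m (f k)\<bar> \<le> d/4 / 2 ^ Suc i))"
    for i :: nat and s :: "nat \<times> nat set"
  have step: "\<exists>k N. k \<in> M \<and> N \<subseteq> M \<and> P i (k, N)" if M: "M \<subseteq> K0" "infinite M" for M i
  proof -
    obtain k where k: "k \<in> M" using M(2) by (metis ex_in_conv finite.emptyI)
    define M' where "M' = {m\<in>M. k < m \<and> \<bar>p m (f k)\<bar> \<le> d/4 / 2 ^ Suc i}"
    have "eventually (\<lambda>m. \<bar>p m (f k)\<bar> < d/4 / 2 ^ Suc i) sequentially"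
      using null[OF f_mem[of k]] d unfolding tendsto_iff dist_real_def by simp
    then obtain m0 where m0: "\<And>m. m \<ge> m0 \<Longrightarrow> \<bar>p m (f k)\<bar> < d/4 / 2 ^ Suc i"
      unfolding eventually_sequentially by blast
    have "M \<subseteq> M' \<union> {..max k m0}"
      unfolding M'_def using m0 by (auto simp: not_less less_imp_le max_def)
    then have "infinite M'" using M(2) by (meson finite_Un finite_atMost finite_subset)
    from small_variation_on_infinite_subset[OF A this, of "d/4" k \<kappa>] d
    obtain N where "N \<subseteq> M'" "infinite N" "variation k (A \<inter> \<kappa> -` N) \<le> d/4" by auto
    then show ?thesis
      using k M(1) unfolding P_def M'_def by (intro exI[of _ k] exI[of _ N]) auto
  qed
  have "\<exists>s. P 0 s" using step[of K0 0] K0 by blast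
  moreover have "\<exists>t. P (Suc i) t \<and> fst t \<in> snd s \<and> snd t \<subseteq> snd s" if "P i s" for i s
  proof -
    have "snd s \<subseteq> K0" "infinite (snd s)" using that by (auto simp: P_def)
    from step[OF this] show ?thesis by fastforce
  qed
  ultimately have "\<exists>s. \<forall>i. P i (s i) \<and>
      (fst (s (Suc i)) \<in> snd (s i) \<and> snd (s (Suc i)) \<subseteq> snd (s i))"
    by (rule dependent_nat_choice)
  then obtain s where s: "\<And>i. P i (s i)"
      and sS: "\<And>i. fst (s (Suc i)) \<in> snd (s i) \<and> snd (s (Suc i)) \<subseteq> snd (s i)"
    by blast
  define k where "k i = fst (s i)" for i
  define N where "N i = snd (s i)" for i
  have kN: "k i \<in> K0" "variation (k i) (A \<inter> \<kappa> -` N i) \<le> d/4"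
      "\<And>m. m \<in> N i \<Longrightarrow> k i < m \<and> \<bar>p m (f (k i))\<bar> \<le> d/4 / 2 ^ Suc i" for i
    using s[of i] by (auto simp: P_def k_def N_def split: prod.splits)
  have "decseq N" unfolding decseq_Suc_iff N_def using sS by blast
  then have later: "k j \<in> N i" if "i < j" for i j
    using that sS[of "j - 1"] unfolding decseq_def k_def N_def
    by (metis Suc_diff_1 Suc_leI diff_Suc_1 gr_implies_not0 le_add_diff_inverse not_gr_zero
        plus_1_eq_Suc add_leD1 less_Suc_eq_le subsetD)
  have mono: "strict_mono k" using kN(3) later by (auto intro: strict_monoI)
  have early: "\<bar>p (k i) (F (k ` {..<j}))\<bar> \<le> d/4 * (1 - 1 / 2 ^ j)" if "j \<le> i" for i j
    using that
  proof (induction j)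
    case 0
    have "F {} = (\<lambda>x. 0)" by (auto simp: F_def)
    then show ?case using zero by simp
  next
    case (Suc j)
    have "k ` {..<Suc j} = k ` {..<j} \<union> {k j}" by (auto simp: less_Suc_eq)
    moreover have "k ` {..<j} \<inter> {k j} = {}"
      using mono by (auto simp: strict_mono_def) (metis less_irrefl)
    ultimately have "p (k i) (F (k ` {..<Suc j})) = p (k i) (F (k ` {..<j})) + p (k i) (f (k j))"
      using F_Un[of "k ` {..<j}" "{k j}" "k i"] F_single by simp
    moreover have "\<bar>p (k i) (f (k j))\<bar> \<le> d/4 / 2 ^ Suc j"
      using kN(3)[OF later[of j i]] Suc.prems by simp
    moreover have "\<bar>p (k i) (F (k ` {..<j}))\<bar> \<le> d/4 * (1 - 1 / 2 ^ j)"
      using Suc by simp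
    ultimately have "\<bar>p (k i) (F (k ` {..<Suc j}))\<bar> \<le> d/4 * (1 - 1 / 2 ^ j) + d/4 / 2 ^ Suc j"
      by linarith
    also have "\<dots> = d/4 * (1 - 1 / 2 ^ Suc j)" by (simp add: field_simps)
    finally show ?case .
  qed
  have large: "d/2 \<le> \<bar>p (k i) (F (range k))\<bar>" for i
  proof -
    define L where "L = k ` {i<..}"
    have "range k = (k ` {..<i} \<union> {k i}) \<union> L" 
    proof -
      have "UNIV = ({..<i} \<union> {i}) \<union> {i<..}" by auto
      then show ?thesis unfolding L_def by (metis image_Un image_empty image_insert)
    qed
    moreover have "k ` {..<i} \<inter> {k i} = {}" "(k ` {..<i} \<union> {k i}) \<inter> L = {}"
      using strict_mono_eq[OF mono] by (auto simp: L_def)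
    ultimately have "p (k i) (F (range k)) = p (k i) (F (k ` {..<i})) + p (k i) (f (k i)) + p (k i) (F L)"
      using F_Un[of "k ` {..<i} \<union> {k i}" L "k i"] F_Un[of "k ` {..<i}" "{k i}" "k i"] F_single by simp
    moreover have "\<bar>p (k i) (F (k ` {..<i}))\<bar> \<le> d/4"
    proof -
      have "d/4 * (1 - 1 / 2 ^ i) \<le> d/4 * 1" using d by (intro mult_left_mono) auto
      then show ?thesis using early[of i i] by simp
    qed
    moreover have "\<bar>p (k i) (F L)\<bar> \<le> d/4"
    proof -
      have "\<bar>p (k i) (F L)\<bar> \<le> variation (k i) (A \<inter> \<kappa> -` N i)"
      proof (rule le_absval)
        show "indicator (A \<inter> \<kappa> -` N i) \<in> null_fun J" using sub by (simp add: null_fun_indicator[OF ideal])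
        have "L \<subseteq> N i" using later by (auto simp: L_def)
        then show "\<bar>F L n\<bar> \<le> indicator (A \<inter> \<kappa> -` N i) n" for n
          by (intro order_trans[OF F_le] indicator_leI) auto
      qed
      then show ?thesis using kN(2)[of i] by simp
    qed
    moreover have "d \<le> \<bar>p (k i) (f (k i))\<bar>" using kN(1)[of i] by (simp add: K0_def)
    ultimately show ?thesis by linarith
  qed
  have "(\<lambda>i. p (k i) (F (range k))) \<longlonglongrightarrow> 0"
    using LIMSEQ_subseq_LIMSEQ[OF null[OF F_mem] mono] by (simp add: o_def)
  then have "eventually (\<lambda>i. \<bar>p (k i) (F (range k))\<bar> < d/2) sequentially"
    using order_tendstoD(2)[OF tendsto_rabs_zero half_gt_zero[OF d]] by blast
  then obtain i where "\<bar>p (k i) (F (range k))\<bar> < d/2"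
    unfolding eventually_sequentially by blast
  then show False using large[of i] by simp
qed

end

section \<open>A pathological density ideal\<close>

lemma (in bdd_functional) finite_support:
  assumes "finite X" "\<And>x. x \<notin> X \<Longrightarrow> f x = 0"
  shows "p f = (\<Sum>x\<in>X. f x * p (indicator {x}))"
proof -
  have ind: "indicator {x} \<in> null_fun J" for x
    using omega_ideal_finite[OF ideal, of "{x}"] by (simp add: null_fun_indicator[OF ideal])
  have "f = (\<lambda>n. \<Sum>x\<in>X. f x * indicator {x} n)"
  proof
    fix n
    have "(\<Sum>x\<in>X. f x * indicator {x} n) = (\<Sum>x\<in>X. if x = n then f n else 0)"
      by (intro sum.cong) (auto simp: indicator_def)
    then show "f n = (\<Sum>x\<in>X. f x * indicator {x} n)" using assms by auto
  qed
  then have "p f = p (\<lambda>n. \<Sum>x\<in>X. f x * indicator {x} n)" by simp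
  also have "\<dots> = (\<Sum>x\<in>X. p (\<lambda>n. f x * indicator {x} n))"
    using sum[OF assms(1), of "\<lambda>x n. f x * indicator {x} n"] null_fun_scale[OF ideal ind] by blast
  also have "\<dots> = (\<Sum>x\<in>X. f x * p (indicator {x}))"
    using scale[OF ind] by simp
  finally show ?thesis .
qed

text \<open>The fibre of \<open>fib\<close> over \<open>n\<close> is a copy of the family of all \<open>n\<close>-element subsets of
  \<open>{..<2 * n}\<close>.  Half of these sets contain a given \<open>i\<close>, but more than \<open>n\<close> points are needed to
  meet all of them.  So the covering number by the sets \<open>{k. i \<in> S k}\<close>, divided by \<open>n\<close>, is a
  submeasure that exceeds one on the whole fibre, whereas every measure on the fibre has half of its
  mass on a set of covering number one, which is asymptotically negligible.\<close>

locale pathological_blocks =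
  fixes fib :: "nat \<Rightarrow> nat" and S :: "nat \<Rightarrow> nat set"
  assumes finite_fib: "\<And>n. finite (fib -` {n})"
    and S_subset: "\<And>k. S k \<subseteq> {..<2 * fib k}"
    and card_S: "\<And>k. card (S k) = fib k"
    and S_onto: "\<And>n a. a \<subseteq> {..<2 * n} \<Longrightarrow> card a = n \<Longrightarrow> \<exists>k. fib k = n \<and> S k = a"
begin

definition covered :: "nat set \<Rightarrow> nat \<Rightarrow> real \<Rightarrow> bool" where
  "covered A n e \<longleftrightarrow>
     (\<exists>I. finite I \<and> real (card I) \<le> e * real n \<and> (\<forall>k\<in>A. fib k = n \<longrightarrow> S k \<inter> I \<noteq> {}))"

definition cover_ideal :: "nat set set" where
  "cover_ideal = {A. \<forall>e>0. eventually (\<lambda>n. covered A n e) sequentially}"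

lemma finite_fib_less: "finite {x. fib x < L}"
proof -
  have "{x. fib x < L} = (\<Union>n<L. fib -` {n})" by auto
  then show ?thesis using finite_fib by simp
qed

lemma covered_subset: "covered B n e \<Longrightarrow> (\<And>k. k \<in> A \<Longrightarrow> fib k = n \<Longrightarrow> k \<in> B) \<Longrightarrow> covered A n e"
  unfolding covered_def by blast

lemma covered_mono:
  assumes "covered A n e" "e \<le> d"
  shows "covered A n d"
proof -
  have "e * real n \<le> d * real n" using assms(2) by (intro mult_right_mono) auto
  then show ?thesis using assms(1) unfolding covered_def by (meson order_trans)
qed

lemma covered_Un:
  assumes "covered A n d" "covered B n e"
  shows "covered (A \<union> B) n (d + e)"
proof -
  obtain I I' where I: "finite I" "real (card I) \<le> d * real n" "\<forall>k\<in>A. fib k = n \<longrightarrow> S k \<inter> I \<noteq> {}"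
    and I': "finite I'" "real (card I') \<le> e * real n" "\<forall>k\<in>B. fib k = n \<longrightarrow> S k \<inter> I' \<noteq> {}"
    using assms unfolding covered_def by blast
  have "real (card (I \<union> I')) \<le> real (card I) + real (card I')"
    using card_Un_le[of I I'] by linarith
  also have "\<dots> \<le> (d + e) * real n" using I(2) I'(2) by (simp add: algebra_simps)
  finally show ?thesis
    unfolding covered_def
  proof (intro exI[of _ "I \<union> I'"] conjI ballI impI)
    fix k assume "k \<in> A \<union> B" "fib k = n"
    then have "S k \<inter> I \<noteq> {} \<or> S k \<inter> I' \<noteq> {}" using I(3) I'(3) by blast
    then show "S k \<inter> (I \<union> I') \<noteq> {}" by blast
  qed (use I(1) I'(1) in auto)
qed

lemma covered_empty: "0 \<le> e \<Longrightarrow> covered {} n e"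
  unfolding covered_def by (intro exI[of _ "{}"]) simp

lemma not_covered_fibre:
  assumes "fib -` {n} \<subseteq> A"
  shows "\<not> covered A n 1"
proof
  assume "covered A n 1"
  then obtain I where I: "finite I" "card I \<le> n" "\<forall>k\<in>A. fib k = n \<longrightarrow> S k \<inter> I \<noteq> {}"
    unfolding covered_def by auto
  have "n \<le> card ({..<2 * n} - I)"
    using diff_card_le_card_Diff[OF I(1), of "{..<2 * n}"] I(2) by simp
  then obtain a where a: "a \<subseteq> {..<2 * n} - I" "card a = n"
    by (meson obtain_subset_with_card_n)
  then obtain k where k: "fib k = n" "S k = a" using S_onto[of a n] by blast
  then have "k \<in> A" using assms by blast
  then show False using I(3) k a(1) by blast
qed

lemma cover_ideal_Un:
  assumes "A \<in> cover_ideal" "B \<in> cover_ideal"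
  shows "A \<union> B \<in> cover_ideal"
  unfolding cover_ideal_def
proof (intro CollectI allI impI)
  fix e :: real assume "e > 0"
  then have "eventually (\<lambda>n. covered A n (e/2)) sequentially" "eventually (\<lambda>n. covered B n (e/2)) sequentially"
    using assms half_gt_zero unfolding cover_ideal_def by blast+
  then show "eventually (\<lambda>n. covered (A \<union> B) n e) sequentially"
    by eventually_elim (use covered_Un[of A _ "e/2" B "e/2"] in simp)
qed

lemma fib_vimage_cover_ideal: "fib -` B \<in> cover_ideal \<longleftrightarrow> finite B"
proof
  assume "fib -` B \<in> cover_ideal"
  then have "eventually (\<lambda>n. covered (fib -` B) n 1) sequentially"
    by (simp add: cover_ideal_def)
  then have "eventually (\<lambda>n. n \<notin> B) sequentially"
    by eventually_elim (use not_covered_fibre in blast)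
  then obtain N where N: "\<And>n. n \<ge> N \<Longrightarrow> n \<notin> B"
    unfolding eventually_sequentially by blast
  then have "B \<subseteq> {..<N}" using not_le by blast
  then show "finite B" using finite_subset by blast
next
  assume B: "finite B"
  show "fib -` B \<in> cover_ideal"
    unfolding cover_ideal_def
  proof (intro CollectI allI impI)
    fix e :: real assume e: "e > 0"
    have "eventually (\<lambda>n. n \<notin> B) sequentially"
      using B unfolding eventually_sequentially finite_nat_set_iff_bounded by (meson not_le)
    then show "eventually (\<lambda>n. covered (fib -` B) n e) sequentially"
      by eventually_elim (rule covered_subset[OF covered_empty], use e in auto)
  qed
qed

lemma omega_ideal_cover_ideal: "omega_ideal cover_ideal"
  unfolding omega_ideal_def
proof (intro conjI allI impI)
  show sub: "B \<in> cover_ideal" if "A \<in> cover_ideal" "B \<subseteq> A" for A B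
  proof -
    have "covered B n e" if "covered A n e" for n e
      using covered_subset[OF that] \<open>B \<subseteq> A\<close> by blast
    then show ?thesis
      using \<open>A \<in> cover_ideal\<close> unfolding cover_ideal_def
      by (blast intro: eventually_mono)
  qed
  show "A \<in> cover_ideal" if "finite A" for A
    by (rule sub[of "fib -` (fib ` A)"]) (use that in \<open>auto simp: fib_vimage_cover_ideal\<close>)
  show "UNIV \<notin> cover_ideal"
    using fib_vimage_cover_ideal[of UNIV] by simp
qed (rule cover_ideal_Un)

text \<open>Half of any finite measure on a fibre sits on the sets containing a suitable point: average
  over the \<open>2 * n\<close> points, each set containing \<open>n\<close> of them.\<close>

lemma exists_half_mass_point:
  assumes X: "finite X" "\<And>k. k \<in> X \<Longrightarrow> fib k = n" and "n > 0"
  shows "\<exists>i. (\<Sum>k\<in>X. w k) \<le> 2 * (\<Sum>k\<in>{k\<in>X. i \<in> S k}. w k :: real)"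
proof (rule ccontr)
  assume "\<not> ?thesis"
  then have less: "2 * (\<Sum>k\<in>{k\<in>X. i \<in> S k}. w k) < (\<Sum>k\<in>X. w k)" for i
    by (simp add: not_le)
  have "(\<Sum>i<2*n. \<Sum>k\<in>{k\<in>X. i \<in> S k}. w k) = (\<Sum>i<2*n. \<Sum>k\<in>X. if i \<in> S k then w k else 0)"
    by (rule sum.cong[OF refl], rule sum.inter_filter[OF X(1)])
  also have "\<dots> = (\<Sum>k\<in>X. \<Sum>i<2*n. if i \<in> S k then w k else 0)"
    by (rule sum.swap)
  also have "\<dots> = (\<Sum>k\<in>X. real n * w k)"
  proof (intro sum.cong refl)
    fix k assume "k \<in> X"
    then have "fib k = n" using X by blast
    then have "{i\<in>{..<2*n}. i \<in> S k} = S k" using S_subset[of k] by auto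
    then show "(\<Sum>i<2*n. if i \<in> S k then w k else 0) = real n * w k"
      using sum.inter_filter[of "{..<2*n}" "\<lambda>_. w k" "\<lambda>i. i \<in> S k"] card_S[of k] \<open>fib k = n\<close> by simp
  qed
  also have "\<dots> = real n * (\<Sum>k\<in>X. w k)" by (simp add: sum_distrib_left)
  finally have eq: "(\<Sum>i<2*n. 2 * (\<Sum>k\<in>{k\<in>X. i \<in> S k}. w k)) = real (2 * n) * (\<Sum>k\<in>X. w k)"
    by (simp add: sum_distrib_left[symmetric])
  have "(\<Sum>i<2*n. 2 * (\<Sum>k\<in>{k\<in>X. i \<in> S k}. w k)) < (\<Sum>i<2*n. (\<Sum>k\<in>X. w k))"
    using less \<open>n > 0\<close> by (intro sum_strict_mono) (auto simp: lessThan_empty_iff)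
  then show False using eq by simp
qed

text \<open>The ideal is a P-ideal.  Over \<open>n\<close> only those \<open>D k\<close> with \<open>l k \<le> n\<close> are present, and \<open>l\<close>
  grows so fast that their union already satisfies a good covering estimate there.\<close>

lemma cover_ideal_pseudo_union:
  assumes D: "\<And>k. D k \<in> cover_ideal"
  obtains l :: "nat \<Rightarrow> nat" where "(\<Union>k. D k \<inter> {x. l k \<le> fib x}) \<in> cover_ideal"
proof -
  define A where "A k = (\<Union>i\<le>k. D i)" for k
  have A: "A k \<in> cover_ideal" for k
    unfolding A_def by (intro omega_ideal_UN[OF omega_ideal_cover_ideal] D) simp
  have "\<exists>m. \<forall>n\<ge>m. covered (A k) n (1 / real (Suc k))" for k
    using A[of k] unfolding cover_ideal_def eventually_sequentially by simp
  then obtain m where m: "\<And>k n. n \<ge> m k \<Longrightarrow> covered (A k) n (1 / real (Suc k))" by metis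
  define l where "l k = k + (\<Sum>i\<le>k. m i)" for k
  have l: "m k \<le> l k" "l k < l (Suc k)" for k
    using member_le_sum[of k "{..k}" m] unfolding l_def by simp_all
  have mono: "strict_mono l" using l(2) by (simp add: strict_mono_Suc_iff)
  have "(\<Union>k. D k \<inter> {x. l k \<le> fib x}) \<in> cover_ideal"
    unfolding cover_ideal_def
  proof (intro CollectI allI impI)
    fix e :: real assume "e > 0"
    then obtain K where K: "1 / real (Suc K) < e" using reals_Archimedean by (auto simp: inverse_eq_divide)
    have "covered (\<Union>k. D k \<inter> {x. l k \<le> fib x}) n e" if n: "n \<ge> l K" for n
    proof -
      \<comment> \<open>the last stage that has begun at the fibre over \<open>n\<close>\<close>
      define k where "k = Max {k. l k \<le> n}"
      have "{k. l k \<le> n} \<subseteq> {..n}"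
        using strict_mono_imp_increasing[OF mono] le_trans by blast
      then have fin: "finite {k. l k \<le> n}" using finite_subset by blast
      have k: "l k \<le> n" "K \<le> k"
        unfolding k_def using Max_in[OF fin] Max_ge[OF fin] n by auto
      have "covered (A k) n (1 / real (Suc k))" using m l(1)[of k] k(1) by (meson order_trans)
      then have "covered (A k) n e"
      proof (rule covered_mono)
        have "1 / real (Suc k) \<le> 1 / real (Suc K)" using k(2) by (intro divide_left_mono) auto
        then show "1 / real (Suc k) \<le> e" using K by simp
      qed
      then show ?thesis
      proof (rule covered_subset)
        fix x assume "x \<in> (\<Union>k. D k \<inter> {x. l k \<le> fib x})" "fib x = n"
        then obtain i where "x \<in> D i" "l i \<le> n" by auto
        moreover from this have "i \<le> k" unfolding k_def using Max_ge[OF fin] by simp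
        ultimately show "x \<in> A k" unfolding A_def by blast
      qed
    qed
    then show "eventually (\<lambda>n. covered (\<Union>k. D k \<inter> {x. l k \<le> fib x}) n e) sequentially"
      unfolding eventually_sequentially by blast
  qed
  then show ?thesis by (rule that)
qed

end

section \<open>Uniform exhaustiveness over the pathological ideal\<close>

context pathological_blocks
begin

text \<open>If the values stay away from \<open>0\<close> on finitely supported \<open>h k\<close>, pass to a subsequence whose
  supports lie, up to a small error, over successive disjoint intervals of fibres.  In each fibre
  keep only the sets through one point, at the cost of half of the mass; the union of what is kept
  has covering numbers at most one, so it belongs to the ideal, against Phillips's lemma.\<close>

lemma finite_support_tendsto_zero:
  assumes seq: "bdd_functional_seq cover_ideal R p"
    and fin: "\<And>k. finite {x. h k x \<noteq> 0}" and h: "\<And>k x. \<bar>h k x\<bar> \<le> 1"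
  shows "(\<lambda>k. p k (h k)) \<longlonglongrightarrow> 0"
proof (rule ccontr)
  interpret bdd_functional_seq cover_ideal R p by (rule seq)
  assume "\<not> ?thesis"
  then obtain d where d: "d > 0" and inf: "infinite {k. d \<le> \<bar>p k (h k)\<bar>}"
    by (rule not_tendsto_zero_real)
  define w where "w k x = \<bar>p k (indicator {x})\<bar>" for k x
  have w_lim: "(\<lambda>k. \<Sum>x\<in>X. w k x) \<longlonglongrightarrow> 0" for X
  proof -
    have "(\<lambda>k. w k x) \<longlonglongrightarrow> 0" for x
      unfolding w_def using omega_ideal_finite[OF ideal, of "{x}"]
      by (intro tendsto_rabs_zero null) (simp add: null_fun_indicator[OF ideal])
    then show ?thesis by (intro tendsto_null_sum)
  qed
  define P where "P s = (case s of (k, L, L') \<Rightarrow> d \<le> \<bar>p k (h k)\<bar> \<and> 1 \<le> L \<and> L \<le> L' \<and>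
      {x. h k x \<noteq> 0} \<subseteq> {x. fib x < L'} \<and> (\<Sum>x\<in>{x. fib x < L}. w k x) \<le> d/2)"
    for s :: "nat \<times> nat \<times> nat"
  have step: "\<exists>k L'. k > k0 \<and> P (k, L, L')" if "1 \<le> L" for k0 L
  proof -
    have "eventually (\<lambda>k. (\<Sum>x\<in>{x. fib x < L}. w k x) < d/2) sequentially"
      using order_tendstoD(2)[OF w_lim half_gt_zero[OF d]] .
    then obtain k1 where k1: "\<And>k. k \<ge> k1 \<Longrightarrow> (\<Sum>x\<in>{x. fib x < L}. w k x) < d/2"
      unfolding eventually_sequentially by blast
    obtain k where k: "k > max k0 k1" "d \<le> \<bar>p k (h k)\<bar>"
      using inf unfolding infinite_nat_iff_unbounded by blast
    define L' where "L' = Max (insert L (Suc ` fib ` {x. h k x \<noteq> 0}))"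
    have "L \<le> L'" unfolding L'_def using fin by (intro Max_ge) auto
    moreover have "fib x < L'" if "h k x \<noteq> 0" for x
    proof -
      have "Suc (fib x) \<le> L'" unfolding L'_def using fin that by (intro Max_ge) auto
      then show ?thesis by simp
    qed
    ultimately show ?thesis
      using k k1[of k] that unfolding P_def by (intro exI[of _ k] exI[of _ L']) auto
  qed
  have "\<exists>s. P s" using step[of 1 0] by blast
  moreover have "\<exists>t. P t \<and> (fst s < fst t \<and> fst (snd t) = snd (snd s))" if "P s" for s
  proof -
    have "1 \<le> snd (snd s)" using that by (auto simp: P_def)
    from step[OF this, of "fst s"] show ?thesis by fastforce
  qed
  ultimately have "\<exists>s. \<forall>i. P (s i) \<and> (fst (s i) < fst (s (Suc i)) \<and> fst (snd (s (Suc i))) = snd (snd (s i)))"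
    by (rule dependent_nat_choice[where P = "\<lambda>_. P"])
  then obtain s where s: "\<And>i. P (s i)"
    and sS: "\<And>i. fst (s i) < fst (s (Suc i))" "\<And>i. fst (snd (s (Suc i))) = snd (snd (s i))"
    by blast
  define k where "k i = fst (s i)" for i
  define L where "L i = fst (snd (s i))" for i
  have k: "d \<le> \<bar>p (k i) (h (k i))\<bar>" "1 \<le> L i" "L i \<le> L (Suc i)"
      "{x. h (k i) x \<noteq> 0} \<subseteq> {x. fib x < L (Suc i)}" "(\<Sum>x\<in>{x. fib x < L i}. w (k i) x) \<le> d/2" for i
    using s[of i] sS(2)[of i] by (auto simp: P_def k_def L_def split: prod.splits)
  have mono_k: "strict_mono k" using sS(1) by (simp add: strict_mono_Suc_iff k_def)
  have mono_L: "mono L" using k(3) by (simp add: mono_iff_le_Suc)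
  have separated: "i = j" if "L i \<le> n" "n < L (Suc i)" "L j \<le> n" "n < L (Suc j)" for i j n
    using that monoD[OF mono_L, of "Suc i" j] monoD[OF mono_L, of "Suc j" i]
    by (meson Suc_leI leD linorder_cases order_trans)
  define X where "X i = {x. L i \<le> fib x \<and> fib x < L (Suc i)}" for i
  have X_fin: "finite (X i)" for i
    using finite_fib_less[of "L (Suc i)"] by (rule rev_finite_subset) (auto simp: X_def)
  have X_mass: "d/2 \<le> (\<Sum>x\<in>X i. w (k i) x)" for i
  proof -
    have "p (k i) (h (k i)) = (\<Sum>x\<in>{x. fib x < L (Suc i)}. h (k i) x * p (k i) (indicator {x}))"
      using k(4)[of i] by (intro finite_support[OF finite_fib_less]) auto
    also have "\<bar>\<dots>\<bar> \<le> (\<Sum>x\<in>{x. fib x < L (Suc i)}. w (k i) x)"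
    proof (rule order_trans[OF sum_abs sum_mono])
      show "\<bar>h (k i) x * p (k i) (indicator {x})\<bar> \<le> w (k i) x" for x
        using mult_right_mono[OF h[of "k i" x], of "w (k i) x"] by (simp add: w_def abs_mult)
    qed
    also have "{x. fib x < L (Suc i)} = {x. fib x < L i} \<union> X i"
      using k(3)[of i] by (auto simp: X_def)
    also have "(\<Sum>x\<in>{x. fib x < L i} \<union> X i. w (k i) x)
        = (\<Sum>x\<in>{x. fib x < L i}. w (k i) x) + (\<Sum>x\<in>X i. w (k i) x)"
      by (rule sum.union_disjoint[OF finite_fib_less X_fin]) (auto simp: X_def)
    finally show ?thesis using k(1)[of i] k(5)[of i] by linarith
  qed
  have "\<exists>c. (\<Sum>x\<in>{x. fib x = n}. w (k i) x) \<le> 2 * (\<Sum>x\<in>{x\<in>{x. fib x = n}. c \<in> S x}. w (k i) x)"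
    if "n > 0" for i n
    using finite_fib[of n] that by (intro exists_half_mass_point) (auto simp: vimage_def)
  then have "\<forall>i n. \<exists>c. n > 0 \<longrightarrow>
      (\<Sum>x\<in>{x. fib x = n}. w (k i) x) \<le> 2 * (\<Sum>x\<in>{x\<in>{x. fib x = n}. c \<in> S x}. w (k i) x)"
    by blast
  then obtain c where c: "\<And>i n. n > 0 \<Longrightarrow>
      (\<Sum>x\<in>{x. fib x = n}. w (k i) x) \<le> 2 * (\<Sum>x\<in>{x\<in>{x. fib x = n}. c i n \<in> S x}. w (k i) x)"
    unfolding choice_iff by blast
  define Y where "Y i = {x\<in>X i. c i (fib x) \<in> S x}" for i
  have Y_fin: "finite (Y i)" for i using X_fin[of i] by (simp add: Y_def)
  have Y_mass: "d/4 \<le> (\<Sum>x\<in>Y i. w (k i) x)" for i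
  proof -
    have "(\<Sum>x\<in>X i. w (k i) x) = (\<Sum>n\<in>{L i..<L (Suc i)}. \<Sum>x\<in>{x\<in>X i. fib x = n}. w (k i) x)"
      using X_fin by (intro sum.group[symmetric]) (auto simp: X_def)
    also have "\<dots> = (\<Sum>n\<in>{L i..<L (Suc i)}. \<Sum>x\<in>{x. fib x = n}. w (k i) x)"
      by (intro sum.cong refl) (auto simp: X_def)
    also have "\<dots> \<le> (\<Sum>n\<in>{L i..<L (Suc i)}. 2 * (\<Sum>x\<in>{x\<in>{x. fib x = n}. c i n \<in> S x}. w (k i) x))"
      using k(2)[of i] by (intro sum_mono c) auto
    also have "\<dots> = 2 * (\<Sum>n\<in>{L i..<L (Suc i)}. \<Sum>x\<in>{x\<in>Y i. fib x = n}. w (k i) x)"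
      unfolding sum_distrib_left[symmetric]
      by (intro arg_cong[where f = "\<lambda>t. 2 * t"] sum.cong refl) (auto simp: X_def Y_def)
    also have "(\<Sum>n\<in>{L i..<L (Suc i)}. \<Sum>x\<in>{x\<in>Y i. fib x = n}. w (k i) x) = (\<Sum>x\<in>Y i. w (k i) x)"
      using Y_fin by (intro sum.group) (auto simp: X_def Y_def)
    finally show ?thesis using X_mass[of i] by linarith
  qed
  define A where "A = (\<Union>i. Y i)"
  have "covered A n e" if "1 \<le> e * real n" for n e
  proof (cases "\<exists>i. L i \<le> n \<and> n < L (Suc i)")
    case True
    then obtain i where i: "L i \<le> n" "n < L (Suc i)" by blast
    have "c i n \<in> S x" if "x \<in> A" "fib x = n" for x
    proof -
      obtain j where j: "x \<in> Y j" using \<open>x \<in> A\<close> unfolding A_def by blast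
      then have "L j \<le> n" "n < L (Suc j)" using \<open>fib x = n\<close> by (auto simp: Y_def X_def)
      then have "j = i" using separated i by blast
      then show ?thesis using j \<open>fib x = n\<close> by (auto simp: Y_def)
    qed
    then show ?thesis
      unfolding covered_def using that by (intro exI[of _ "{c i n}"]) auto
  next
    case False
    then have "\<And>k. k \<in> A \<Longrightarrow> fib k \<noteq> n" unfolding A_def Y_def X_def by blast
    moreover have "0 \<le> e" using that by (cases "n = 0") (auto simp: zero_le_mult_iff dest: order_trans[OF zero_le_one])
    ultimately show ?thesis using covered_subset[OF covered_empty] by blast
  qed
  moreover have "eventually (\<lambda>n. 1 \<le> e * real n) sequentially" if "e > 0" for e
  proof -
    obtain N where "1 / e \<le> real N" using real_arch_simple by blast
    then have "1 \<le> e * real n" if "n \<ge> N" for n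
      using that \<open>e > 0\<close> by (simp add: divide_le_eq mult.commute) (meson of_nat_mono mult_left_mono less_imp_le order_trans)
    then show ?thesis unfolding eventually_sequentially by blast
  qed
  ultimately have A: "A \<in> cover_ideal"
    unfolding cover_ideal_def by (blast intro: eventually_mono)
  define g where "g i x = (if x \<in> Y i then sgn (p (k i) (indicator {x})) else 0)" for i x
  interpret sub: bdd_functional_seq cover_ideal R "\<lambda>i. p (k i)" by (rule subseq[OF mono_k])
  have "(\<lambda>i. p (k i) (g i)) \<longlonglongrightarrow> 0"
  proof (rule sub.phillips[OF A])
    show "\<bar>g i x\<bar> \<le> indicator A x" for i x
      by (auto simp: g_def A_def indicator_def sgn_if)
    show "i = j" if "g i x \<noteq> 0" "g j x \<noteq> 0" for i j x
      using that separated[of i "fib x" j] by (auto simp: g_def Y_def X_def split: if_splits)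
  qed
  moreover have "d/4 \<le> p (k i) (g i)" for i
  proof -
    have "p (k i) (g i) = (\<Sum>x\<in>Y i. g i x * p (k i) (indicator {x}))"
      by (rule finite_support[OF Y_fin]) (simp add: g_def)
    also have "\<dots> = (\<Sum>x\<in>Y i. w (k i) x)"
      by (intro sum.cong refl) (simp add: g_def w_def abs_sgn mult.commute)
    finally show ?thesis using Y_mass by simp
  qed
  ultimately have "d/4 \<le> 0" by (intro LIMSEQ_le_const) auto
  then show False using d by simp
qed

text \<open>Split each function at a fibre.  The parts below it have finite support; by the P-ideal
  property the splitting can be arranged so that the parts above it live on one member of the ideal,
  where Phillips's lemma applies.\<close>

lemma disjoint_tendsto_zero:
  assumes seq: "bdd_functional_seq cover_ideal R p"
    and D: "\<And>k. D k \<in> cover_ideal" "disjoint_family D"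
    and f: "\<And>k x. \<bar>f k x\<bar> \<le> indicator (D k) x"
  shows "(\<lambda>k. p k (f k)) \<longlonglongrightarrow> 0"
proof -
  interpret bdd_functional_seq cover_ideal R p by (rule seq)
  obtain l :: "nat \<Rightarrow> nat" where l: "(\<Union>k. D k \<inter> {x. l k \<le> fib x}) \<in> cover_ideal"
    by (rule cover_ideal_pseudo_union[OF D(1)])
  have f_supp: "f k x = 0" if "x \<notin> D k" for k x
    using f[of k x] that by simp
  have f_le: "\<bar>f k x\<bar> \<le> 1" for k x
    using order_trans[OF f indicator_le_1] .
  define h where "h k x = (if fib x < l k then f k x else 0)" for k x
  define t where "t k x = (if fib x < l k then 0 else f k x)" for k x
  have "(\<lambda>k. p k (h k)) \<longlonglongrightarrow> 0"
  proof (rule finite_support_tendsto_zero[OF seq])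
    show "finite {x. h k x \<noteq> 0}" for k
      by (rule finite_subset[OF _ finite_fib_less[of "l k"]]) (auto simp: h_def)
    show "\<bar>h k x\<bar> \<le> 1" for k x using f_le by (simp add: h_def)
  qed
  moreover have "(\<lambda>k. p k (t k)) \<longlonglongrightarrow> 0"
  proof (rule phillips[OF l])
    show "\<bar>t k x\<bar> \<le> indicator (\<Union>k. D k \<inter> {x. l k \<le> fib x}) x" for k x
      using f_le[of k x] f_supp[of x k] by (auto simp: t_def indicator_def not_less)
    show "j = k" if "t j x \<noteq> 0" "t k x \<noteq> 0" for j k x
    proof -
      have "x \<in> D j" "x \<in> D k" using that f_supp by (auto simp: t_def split: if_splits)
      then show ?thesis using D(2) by (auto simp: disjoint_family_on_def)
    qed
  qed
  ultimately have "(\<lambda>k. p k (h k) + p k (t k)) \<longlonglongrightarrow> 0" using tendsto_add by fastforce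
  moreover have "p k (f k) = p k (h k) + p k (t k)" for k
  proof -
    have "f k \<in> null_fun cover_ideal"
      by (rule null_fun_support[OF ideal D(1)[of k], of _ 1]) (use f in simp)
    then have "h k \<in> null_fun cover_ideal" "t k \<in> null_fun cover_ideal"
      by (auto intro: null_fun_solid[OF ideal, of "f k"] simp: h_def t_def)
    moreover have "f k = (\<lambda>x. h k x + t k x)" by (auto simp: h_def t_def)
    ultimately show ?thesis using add by simp
  qed
  ultimately show ?thesis by simp
qed

lemma uniformly_exhaustive:
  fixes D :: "nat \<Rightarrow> nat set"
  assumes seq: "bdd_functional_seq cover_ideal R p"
    and D: "\<And>k. D k \<in> cover_ideal" "disjoint_family D" and "e > 0"
  shows "\<exists>k. \<forall>n. absval (p n) (indicator (D k)) < e"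
proof (rule ccontr)
  interpret bdd_functional_seq cover_ideal R p by (rule seq)
  assume "\<not> ?thesis"
  then obtain n where n: "\<And>k. e \<le> variation (n k) (D k)" by (metis not_le)
  \<comment> \<open>a single functional has small variation on all but finitely many of the disjoint sets\<close>
  have fin: "finite {k. n k = m}" for m
  proof (rule ccontr)
    assume inf: "infinite {k. n k = m}"
    obtain N where N: "R / e < real N" using reals_Archimedean2 by blast
    obtain I where I: "I \<subseteq> {k. n k = m}" "finite I" "card I = N"
      using infinite_arbitrarily_large[OF inf] by blast
    have "real N * e \<le> (\<Sum>k\<in>I. variation m (D k))"
      using sum_bounded_below[of I e "\<lambda>k. variation m (D k)"] n I by fastforce
    also have "\<dots> \<le> R"
      using D(2) by (intro variation_disjoint_sum_le I D(1)) (auto simp: disjoint_family_on_def)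
    finally show False using N \<open>e > 0\<close> by (simp add: field_simps)
  qed
  have "\<exists>r'. True \<and> (r < r' \<and> n r < n r')" for r
  proof -
    have "finite ({..r} \<union> (\<Union>m\<le>n r. {k. n k = m}))" using fin by simp
    then obtain r' where "r' \<notin> {..r} \<union> (\<Union>m\<le>n r. {k. n k = m})"
      using infinite_UNIV_nat ex_new_if_finite by blast
    then show ?thesis by (auto simp: not_le)
  qed
  then obtain r where r: "\<And>i :: nat. r i < r (Suc i)" "\<And>i. n (r i) < n (r (Suc i))"
    using dependent_nat_choice[of "\<lambda>_ _. True" "\<lambda>_ r r'. r < r' \<and> n r < n r'"] by blast
  have mono: "strict_mono r" "strict_mono (\<lambda>i. n (r i))" using r by (simp_all add: strict_mono_Suc_iff)
  have "\<exists>f. (\<forall>x. \<bar>f x\<bar> \<le> indicator (D (r i)) x) \<and> e/2 < p (n (r i)) f" for i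
  proof (rule absval_approx[of "indicator (D (r i))" "e/2" "n (r i)"])
    show "e/2 < variation (n (r i)) (D (r i))" using n[of "r i"] \<open>e > 0\<close> by simp
  qed (simp, blast)
  then obtain f where f: "\<And>i x. \<bar>f i x\<bar> \<le> indicator (D (r i)) x" "\<And>i. e/2 < p (n (r i)) (f i)"
    by metis
  have "disjoint_family (\<lambda>i. D (r i))"
    using D(2) strict_mono_eq[OF mono(1)] unfolding disjoint_family_on_def by blast
  from disjoint_tendsto_zero[OF subseq[OF mono(2)] D(1) this f(1)]
  have "(\<lambda>i. p (n (r i)) (f i)) \<longlonglongrightarrow> 0" .
  then have "e/2 \<le> 0" by (rule LIMSEQ_le_const) (use f(2) less_imp_le in blast)
  then show False using \<open>e > 0\<close> by simp
qed

end

section \<open>Uniform exhaustiveness and weak compactness\<close>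

context bdd_functional_seq
begin

text \<open>Asking for a single small member of every disjoint sequence suffices: applied to
  subsequences, it makes all members small from some index on.\<close>

definition exhaustive :: bool where
  "exhaustive \<longleftrightarrow> (\<forall>D e. (\<forall>k. D k \<in> J) \<longrightarrow> disjoint_family D \<longrightarrow> e > 0 \<longrightarrow>
     (\<exists>k::nat. \<forall>n. variation n (D k) < e))"

text \<open>The Cauchy form of exhaustiveness for monotone sequences of sets, where \<open>D i j\<close> is the
  difference between stages \<open>i\<close> and \<open>j\<close>.\<close>

lemma exhaustive_increments:
  fixes D :: "nat \<Rightarrow> nat \<Rightarrow> nat set"
  assumes exhaustive "\<And>i j. D i j \<in> J" "e > 0"
    and disj: "\<And>i j i' j'. i < j \<Longrightarrow> j \<le> i' \<Longrightarrow> i' < j' \<Longrightarrow> D i j \<inter> D i' j' = {}"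
  shows "\<exists>i. \<forall>j>i. \<forall>n. variation n (D i j) < e"
proof (rule ccontr)
  assume "\<not> ?thesis"
  then obtain s where s: "\<And>i. s i > i" "\<And>i. \<exists>n. \<not> variation n (D i (s i)) < e"
    by metis
  define a where "a k = (s ^^ k) 0" for k
  have a: "a (Suc k) = s (a k)" for k by (simp add: a_def)
  have mono: "strict_mono a" using s(1) a by (simp add: strict_mono_Suc_iff)
  have "D (a i) (a (Suc i)) \<inter> D (a j) (a (Suc j)) = {}" if "i < j" for i j
    using that strict_mono_less_eq[OF mono, of "Suc i" j] by (intro disj) (auto simp: a s(1))
  then have "disjoint_family (\<lambda>k. D (a k) (a (Suc k)))"
    unfolding disjoint_family_on_def by (metis Int_commute linorder_neqE_nat)
  then obtain k where "\<forall>n. variation n (D (a k) (a (Suc k))) < e"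
    using assms(1-3) unfolding exhaustive_def by meson
  then show False using s(2)[of "a k"] a by simp
qed

text \<open>Exhaustiveness upgrades the continuity of each single variation to uniform continuity: the
  sets \<open>E k\<close> become small for every fixed functional, hence so for all of them together.  The
  unions of tails of \<open>E\<close> need not belong to \<open>J\<close>; exhaustiveness replaces them by finite unions
  \<open>G k\<close>, and the decreasing intersections \<open>H k\<close> of these still carry the mass of \<open>E k\<close>.\<close>

lemma no_concentration:
  assumes exh: exhaustive and E: "\<And>k. E k \<in> J" and "e > 0"
    and small: "\<And>n k. variation n (E k) \<le> 2 ^ n * (1/2) ^ k"
    and large: "\<And>k. e \<le> variation (\<nu> k) (E k)"
  shows False
proof -
  have sub: "X \<in> J" if "X \<subseteq> Y" "Y \<in> J" for X Y using that omega_ideal_subset[OF ideal] by blast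
  define U where "U k m = (\<Union>j\<in>{k..k+m}. E j)" for k m
  have U: "U k m \<in> J" for k m unfolding U_def using E by (intro omega_ideal_UN[OF ideal]) auto
  have U_mono: "U k m \<subseteq> U k m'" if "m \<le> m'" for k m m'
    unfolding U_def using that by (intro UN_mono) auto
  have "\<exists>i. \<forall>j>i. \<forall>n. variation n (U k j - U k i) < e/2 / 2 ^ Suc k" for k
  proof (rule exhaustive_increments[OF exh])
    show "U k j - U k i \<in> J" for i j using sub[OF _ U[of k j]] by blast
    show "(U k j - U k i) \<inter> (U k j' - U k i') = {}" if "i < j" "j \<le> i'" "i' < j'" for i j i' j'
      using U_mono[OF that(2), of k] by blast
  qed (use \<open>e > 0\<close> in simp)
  then obtain m where m: "\<And>k j n. j > m k \<Longrightarrow> variation n (U k j - U k (m k)) < e/2 / 2 ^ Suc k"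
    by metis
  define G where "G k = U k (m k)" for k
  define H where "H k = (\<Inter>i\<le>k. G i)" for k
  have G: "G k \<in> J" for k using U by (simp add: G_def)
  have H: "H k \<in> J" for k by (rule sub[OF _ G[of k]]) (auto simp: H_def)
  have H_decr: "H k' \<subseteq> H k" if "k \<le> k'" for k k' using that by (auto simp: H_def)
  have E_diff: "variation n (E k - G i) \<le> e/2 / 2 ^ Suc i" if "i < k" for n k i
  proof -
    define j where "j = max (Suc (m i)) (k - i)"
    have "k \<in> {i..i + j}" using that by (auto simp: j_def)
    then have "E k \<subseteq> U i j" unfolding U_def by blast
    then have "variation n (E k - G i) \<le> variation n (U i j - G i)"
      using sub[OF _ U[of i j]] by (intro variation_mono) blast+
    also have "\<dots> < e/2 / 2 ^ Suc i" using m[of i j n] by (simp add: G_def j_def)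
    finally show ?thesis by simp
  qed
  have H_large: "e/2 \<le> variation (\<nu> k) (H k)" for k
  proof -
    have "k \<in> {k..k + m k}" by simp
    then have "E k \<subseteq> G k" unfolding G_def U_def by blast
    moreover have "x \<in> G k \<Longrightarrow> x \<in> H k \<or> (\<exists>i<k. x \<notin> G i)" for x
      unfolding H_def using le_neq_implies_less by blast
    ultimately have "E k \<subseteq> H k \<union> (\<Union>i<k. E k - G i)" by blast
    moreover have Dif: "(\<Union>i<k. E k - G i) \<in> J" by (rule sub[OF _ E[of k]]) blast
    ultimately have "variation (\<nu> k) (E k) \<le> variation (\<nu> k) (H k \<union> (\<Union>i<k. E k - G i))"
      by (intro variation_mono omega_ideal_Un[OF ideal H])
    also have "\<dots> \<le> variation (\<nu> k) (H k) + variation (\<nu> k) (\<Union>i<k. E k - G i)"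
      by (rule variation_Un_le[OF H Dif])
    also have "variation (\<nu> k) (\<Union>i<k. E k - G i) \<le> (\<Sum>i<k. variation (\<nu> k) (E k - G i))"
      using sub[OF _ E[of k]] by (intro variation_UN_le) blast+
    also have "\<dots> \<le> (\<Sum>i<k. e/2 * (1/2) ^ Suc i)"
      using E_diff by (intro sum_mono) (auto simp: power_divide)
    also have "\<dots> = e/2 * (1 - (1/2) ^ k)"
    proof -
      have "(\<Sum>i<k. (1/2::real) ^ Suc i) = 1 - (1/2) ^ k" by (induction k) auto
      then show ?thesis by (simp only: sum_distrib_left[symmetric])
    qed
    also have "\<dots> \<le> e/2 * 1" using \<open>e > 0\<close> by (intro mult_left_mono) auto
    finally show ?thesis using large[of k] by linarith
  qed
  have "\<exists>i. \<forall>j>i. \<forall>n. variation n (H i - H j) < e/4"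
  proof (rule exhaustive_increments[OF exh])
    show "H i - H j \<in> J" for i j using sub[OF _ H[of i]] by blast
    show "(H i - H j) \<inter> (H i' - H j') = {}" if "i < j" "j \<le> i'" "i' < j'" for i j i' j'
      using H_decr[OF that(2)] by blast
  qed (use \<open>e > 0\<close> in simp)
  then obtain i where i: "\<And>j n. j > i \<Longrightarrow> variation n (H i - H j) < e/4" by blast
  define C :: real where "C = 2 ^ \<nu> i * 2"
  have G_small: "variation (\<nu> i) (G j) \<le> C * (1/2) ^ j" for j
  proof -
    have "variation (\<nu> i) (G j) \<le> (\<Sum>l\<in>{j..j + m j}. variation (\<nu> i) (E l))"
      unfolding G_def U_def using E by (intro variation_UN_le) auto
    also have "\<dots> \<le> (\<Sum>l\<in>{j..j + m j}. 2 ^ \<nu> i * (1/2) ^ l)"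
      by (intro sum_mono small)
    also have "\<dots> = 2 ^ \<nu> i * (\<Sum>l\<in>{j..j + m j}. (1/2) ^ l)" by (simp add: sum_distrib_left)
    also have "(\<Sum>l\<in>{j..j + m j}. (1/2::real) ^ l) = 2 * (1/2) ^ j - 2 * (1/2) ^ (Suc (j + m j))"
      by (induction "m j") (simp_all add: sum_gp)
    also have "2 ^ \<nu> i * \<dots> \<le> C * (1/2) ^ j" unfolding C_def by (simp add: algebra_simps)
    finally show ?thesis by simp
  qed
  have "(\<lambda>j. C * (1/2) ^ j) \<longlonglongrightarrow> C * 0" by (intro tendsto_intros) simp
  then have "eventually (\<lambda>j. C * (1/2) ^ j < e/4) sequentially"
    using order_tendstoD(2)[of _ "C * 0" sequentially "e/4"] \<open>e > 0\<close> by simp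
  moreover have "eventually (\<lambda>j. j > i) sequentially" by (rule eventually_gt_at_top)
  ultimately have "eventually (\<lambda>j. C * (1/2) ^ j < e/4 \<and> j > i) sequentially" by eventually_elim simp
  then obtain j where j: "C * (1/2) ^ j < e/4" "j > i" unfolding eventually_sequentially by blast
  have "variation (\<nu> i) (H i) \<le> variation (\<nu> i) ((H i - H j) \<union> G j)"
    using sub[OF _ H[of i], of "H i - H j"] G by (intro variation_mono omega_ideal_Un[OF ideal]) (auto simp: H_def)
  also have "\<dots> \<le> variation (\<nu> i) (H i - H j) + variation (\<nu> i) (G j)"
    using sub[OF _ H[of i], of "H i - H j"] by (intro variation_Un_le G) auto
  also have "\<dots> < e/2" using i[OF j(2), of "\<nu> i"] G_small[of j] j(1) by linarith
  finally show False using H_large[of i] by simp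
qed

text \<open>A control functional: a positive functional dominating a multiple of every variation.\<close>

definition control :: "(nat \<Rightarrow> real) \<Rightarrow> real" where
  "control g = (\<Sum>n. (1/2) ^ n * absval (p n) g)"

lemma control_summable:
  assumes "g \<in> null_fun J" "\<And>k. 0 \<le> g k"
  shows "summable (\<lambda>n. (1/2) ^ n * absval (p n) g)"
proof -
  obtain B where B: "\<And>k. \<bar>g k\<bar> \<le> B" using null_fun_bound[OF assms(1)] by blast
  have B': "g k \<le> B" for k using B[of k] by simp
  show ?thesis
  proof (rule summable_comparison_test')
    show "summable (\<lambda>n. (1/2) ^ n * (R * B))" by (intro summable_mult2 summable_geometric) simp
    show "norm ((1/2) ^ n * absval (p n) g) \<le> (1/2) ^ n * (R * B)" for n
      using absval_le_bound[OF assms B', of n] absval_nonneg[OF assms, of n] by (simp add: abs_mult)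
  qed
qed

lemma control_nonneg:
  assumes "g \<in> null_fun J" "\<And>k. 0 \<le> g k"
  shows "0 \<le> control g"
  unfolding control_def by (intro suminf_nonneg control_summable assms) (simp add: absval_nonneg assms)

lemma control_add:
  assumes "g \<in> null_fun J" "\<And>k. 0 \<le> g k" "h \<in> null_fun J" "\<And>k. 0 \<le> h k"
  shows "control (\<lambda>k. g k + h k) = control g + control h"
  unfolding control_def
  using suminf_add[OF control_summable[OF assms(1,2)] control_summable[OF assms(3,4)]]
  by (simp add: absval_add[OF assms] algebra_simps)

lemma control_scale_le:
  assumes "g \<in> null_fun J" "\<And>k. 0 \<le> g k" "0 < c"
  shows "control (\<lambda>k. c * g k) \<le> c * control g"
proof -
  have cg: "(\<lambda>k. c * g k) \<in> null_fun J" by (rule null_fun_scale[OF ideal assms(1)])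
  have "control (\<lambda>k. c * g k) \<le> (\<Sum>n. c * ((1/2) ^ n * absval (p n) g))"
    unfolding control_def
  proof (rule suminf_le)
    show "(1/2) ^ n * absval (p n) (\<lambda>k. c * g k) \<le> c * ((1/2) ^ n * absval (p n) g)" for n
      using absval_scale_le[OF assms, of n] by simp
    show "summable (\<lambda>n. (1/2) ^ n * absval (p n) (\<lambda>k. c * g k))"
      using assms by (intro control_summable cg) simp
    show "summable (\<lambda>n. c * ((1/2) ^ n * absval (p n) g))"
      by (intro summable_mult control_summable assms)
  qed
  also have "\<dots> = c * control g" unfolding control_def
    by (intro suminf_mult control_summable assms)
  finally show ?thesis .
qed

lemma absval_le_control:
  assumes "g \<in> null_fun J" "\<And>k. 0 \<le> g k"
  shows "absval (p n) g \<le> 2 ^ n * control g"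
proof -
  have "(\<Sum>i\<in>{n}. (1/2) ^ i * absval (p i) g) \<le> control g"
    unfolding control_def
    by (rule sum_le_suminf[OF control_summable[OF assms]]) (simp_all add: absval_nonneg assms)
  then show ?thesis by (simp add: field_simps)
qed

text \<open>Almost minimisers of the squared seminorm \<open>control (\<lambda>k. (f k)\<^sup>2)\<close> over a decreasing sequence
  of convex sets form a Cauchy sequence, by the parallelogram identity.\<close>

lemma control_Cauchy_selection:
  assumes ne: "\<And>N. \<exists>f\<in>null_fun J. (\<forall>k. \<bar>f k\<bar> \<le> K) \<and> (\<forall>i<N. e \<le> p i f)"
  obtains x where "\<And>N. x N \<in> null_fun J" "\<And>N k. \<bar>x N k\<bar> \<le> K" "\<And>N i. i < N \<Longrightarrow> e \<le> p i (x N)"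
    "\<And>d. d > 0 \<Longrightarrow> \<exists>M. \<forall>N\<ge>M. control (\<lambda>k. (x N k - x M k)\<^sup>2) \<le> d"
proof -
  define Q where "Q N = {f\<in>null_fun J. (\<forall>k. \<bar>f k\<bar> \<le> K) \<and> (\<forall>i<N. e \<le> p i f)}" for N
  define q where "q f = control (\<lambda>k. (f k)\<^sup>2)" for f
  define r where "r N = (INF f\<in>Q N. q f)" for N
  have sq: "(\<lambda>k. (f k)\<^sup>2) \<in> null_fun J" if "f \<in> null_fun J" for f
    by (rule null_fun_square[OF ideal that])
  have q_nonneg: "0 \<le> q f" if "f \<in> null_fun J" for f
    unfolding q_def by (intro control_nonneg sq that) simp
  have bdd: "bdd_below (q ` Q N)" for N
    by (intro bdd_belowI[of _ 0]) (auto simp: Q_def q_nonneg)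
  have Q_ne: "Q N \<noteq> {}" for N using ne[of N] by (auto simp: Q_def)
  have Q_anti: "Q N \<subseteq> Q M" if "M \<le> N" for M N using that by (auto simp: Q_def)
  have r_le: "r N \<le> q f" if "f \<in> Q N" for N f unfolding r_def by (rule cINF_lower[OF bdd that])
  have r_mono: "r M \<le> r N" if "M \<le> N" for M N
    unfolding r_def by (rule cINF_superset_mono[OF Q_ne bdd Q_anti[OF that]]) simp
  have "\<exists>L. r \<longlonglongrightarrow> L \<and> (\<forall>N. r N \<le> L)"
  proof -
    have "r N \<le> 2 * R * K\<^sup>2" for N
    proof -
      obtain f where f: "f \<in> Q N" using Q_ne by blast
      have fN: "f \<in> null_fun J" "\<And>k. (f k)\<^sup>2 \<le> K\<^sup>2"
        using f unfolding Q_def by (auto simp: abs_le_square_iff[symmetric] intro: order_trans[OF _ abs_ge_self])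
      have "q f \<le> (\<Sum>n. (1/2) ^ n * (R * K\<^sup>2))"
        unfolding q_def control_def
        by (intro suminf_le mult_left_mono absval_le_bound control_summable sq fN
            summable_mult2 summable_geometric) auto
      also have "\<dots> = 2 * R * K\<^sup>2"
        using suminf_geometric[of "1/2::real"] by (simp add: suminf_mult2[symmetric] summable_geometric)
      finally show ?thesis using r_le[OF f] by simp
    qed
    then have "convergent r"
      using r_mono by (intro Bseq_mono_convergent[OF incseq_bounded[of r]]) (auto simp: incseq_def)
    then obtain L where "r \<longlonglongrightarrow> L" unfolding convergent_def by blast
    moreover have "r N \<le> L" for N
      by (rule incseq_le[OF _ \<open>r \<longlonglongrightarrow> L\<close>]) (simp add: incseq_def r_mono)
    ultimately show ?thesis by blast
  qed
  then obtain L where L: "r \<longlonglongrightarrow> L" "\<And>N. r N \<le> L" by blast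
  have "\<exists>f\<in>Q N. q f < r N + 1 / real (Suc N)" for N
    using cINF_less_iff[OF Q_ne[of N] bdd, of "r N + 1 / real (Suc N)"] unfolding r_def by simp
  then obtain x where x: "\<And>N. x N \<in> Q N" "\<And>N. q (x N) < r N + 1 / real (Suc N)" by metis
  have xm: "x N \<in> null_fun J" for N using x(1)[of N] by (simp add: Q_def)
  have diff_le: "q (\<lambda>k. x N k - x M k) \<le> 2 * (L - r M) + 4 / real (Suc M)" if "M \<le> N" for M N
  proof -
    define u v where "u = x N" and "v = x M"
    have uv: "u \<in> Q M" "v \<in> Q M" using x(1) Q_anti[OF that] unfolding u_def v_def by blast+
    have m: "u \<in> null_fun J" "v \<in> null_fun J" using xm by (simp_all add: u_def v_def)
    have s: "(\<lambda>k. u k + v k) \<in> null_fun J" and d: "(\<lambda>k. u k - v k) \<in> null_fun J"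
      using m by (auto intro: null_fun_add[OF ideal] null_fun_diff[OF ideal])
    have "(\<lambda>k. (1/2) * (u k + v k)) \<in> Q M"
    proof -
      have "e \<le> p i (\<lambda>k. (1/2) * (u k + v k))" if "i < M" for i
      proof -
        have lin: "p i (\<lambda>k. (1/2) * (u k + v k)) = (p i u + p i v) / 2"
          using scale[OF s, of i "1/2"] add[OF m] by simp
        have "e \<le> p i u" "e \<le> p i v" using uv that by (auto simp: Q_def)
        then have "e \<le> (p i u + p i v) / 2" using add_mono by fastforce
        then show ?thesis by (simp only: lin)
      qed
      moreover have "\<bar>(1/2) * (u k + v k)\<bar> \<le> K" for k
        using uv abs_triangle_ineq[of "u k" "v k"] by (auto simp: Q_def abs_mult) (smt (verit))
      ultimately show ?thesis using null_fun_scale[OF ideal s, of "1/2"] by (simp add: Q_def)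
    qed
    then have "r M \<le> q (\<lambda>k. (1/2) * (u k + v k))" by (rule r_le)
    also have "\<dots> = control (\<lambda>k. (1/4) * (u k + v k)\<^sup>2)"
      by (simp add: q_def power_mult_distrib power2_eq_square)
    also have "\<dots> \<le> (1/4) * q (\<lambda>k. u k + v k)"
      unfolding q_def by (intro control_scale_le sq s) auto
    finally have mid: "4 * r M \<le> q (\<lambda>k. u k + v k)" by simp
    have "q (\<lambda>k. u k + v k) + q (\<lambda>k. u k - v k)
        = control (\<lambda>k. (u k + v k)\<^sup>2 + (u k - v k)\<^sup>2)"
      unfolding q_def by (intro control_add[symmetric] sq s d) auto
    also have "\<dots> = control (\<lambda>k. 2 * ((u k)\<^sup>2 + (v k)\<^sup>2))"
      by (intro arg_cong[where f = control]) (auto simp: power2_eq_square algebra_simps)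
    also have "\<dots> \<le> 2 * control (\<lambda>k. (u k)\<^sup>2 + (v k)\<^sup>2)"
      by (intro control_scale_le null_fun_add[OF ideal] sq m) auto
    also have "control (\<lambda>k. (u k)\<^sup>2 + (v k)\<^sup>2) = q u + q v"
      unfolding q_def by (intro control_add sq m) auto
    finally have "q (\<lambda>k. u k - v k) \<le> 2 * (q u + q v) - 4 * r M" using mid by linarith
    also have "q u \<le> L + 1 / real (Suc M)"
    proof -
      have "1 / real (Suc N) \<le> 1 / real (Suc M)" using that by (intro divide_left_mono) auto
      then show ?thesis using x(2)[of N] L(2)[of N] unfolding u_def by linarith
    qed
    also have "q v \<le> r M + 1 / real (Suc M)" using x(2)[of M] unfolding v_def by simp
    finally show ?thesis unfolding u_def v_def by (simp add: algebra_simps)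
  qed
  show ?thesis
  proof
    show "x N \<in> null_fun J" "\<bar>x N k\<bar> \<le> K" "i < N \<Longrightarrow> e \<le> p i (x N)" for N k i
      using x(1)[of N] by (auto simp: Q_def)
    fix d :: real assume "d > 0"
    have "(\<lambda>M. 2 * (L - r M) + 4 * inverse (real (Suc M))) \<longlonglongrightarrow> 2 * (L - L) + 4 * 0"
      by (intro tendsto_intros L(1) LIMSEQ_inverse_real_of_nat)
    then have "eventually (\<lambda>M. 2 * (L - r M) + 4 * inverse (real (Suc M)) < d) sequentially"
      using order_tendstoD(2) \<open>d > 0\<close> by fastforce
    then obtain M where "2 * (L - r M) + 4 / real (Suc M) < d"
      unfolding eventually_sequentially by (auto simp: divide_inverse)
    then show "\<exists>M. \<forall>N\<ge>M. control (\<lambda>k. (x N k - x M k)\<^sup>2) \<le> d"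
      using diff_le unfolding q_def by (meson less_imp_le order_trans)
  qed
qed

text \<open>This is the weak compactness step.  Take points \<open>x N\<close> witnessing positivity that form a
  Cauchy sequence for the seminorm given by the control functional.  A difference \<open>x N - x M\<close> is small in that
  seminorm, yet some functional of large index is at most \<open>e/2\<close> at \<open>x M\<close> and at least \<open>e\<close> at
  \<open>x N\<close>.  So the variations of the functionals concentrate on the small sets where these
  differences are not small.\<close>

lemma exhaustive_imp_not_uniformly_positive:
  assumes exh: exhaustive and "e > 0" and "K > 0"
    and ne: "\<And>N. \<exists>f\<in>null_fun J. (\<forall>k. \<bar>f k\<bar> \<le> K) \<and> (\<forall>i<N. e \<le> p i f)"
  shows False
proof -
  obtain x where x: "\<And>N. x N \<in> null_fun J" "\<And>N k. \<bar>x N k\<bar> \<le> K" "\<And>N i. i < N \<Longrightarrow> e \<le> p i (x N)"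
    and Cauchy: "\<And>d. d > 0 \<Longrightarrow> \<exists>M. \<forall>N\<ge>M. control (\<lambda>k. (x N k - x M k)\<^sup>2) \<le> d"
    using control_Cauchy_selection[OF ne] by blast
  \<comment> \<open>where a difference is below \<open>d\<close>, it contributes at most \<open>e/4\<close> to the value of a functional\<close>
  define d where "d = e / (4 * (R + 1))"
  have d: "d > 0" "R * d \<le> e/4"
  proof -
    show "d > 0" using \<open>e > 0\<close> R_nonneg by (simp add: d_def)
    then have "R * d \<le> (R + 1) * d" by (simp add: algebra_simps)
    also have "\<dots> = e/4" using R_nonneg by (simp add: d_def field_simps)
    finally show "R * d \<le> e/4" .
  qed
  have "\<exists>z n. z \<in> null_fun J \<and> (\<forall>l. \<bar>z l\<bar> \<le> 2 * K) \<and> control (\<lambda>l. (z l)\<^sup>2) \<le> d\<^sup>2 * (1/2) ^ k \<and> e/2 \<le> p n z"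
    for k
  proof -
    obtain M where M: "\<And>N. N \<ge> M \<Longrightarrow> control (\<lambda>l. (x N l - x M l)\<^sup>2) \<le> d\<^sup>2 * (1/2) ^ k"
      using Cauchy[of "d\<^sup>2 * (1/2) ^ k"] d(1) by auto
    have "eventually (\<lambda>n. \<bar>p n (x M)\<bar> < e/2) sequentially"
      using order_tendstoD(2)[OF tendsto_rabs_zero[OF null[OF x(1)]] half_gt_zero[OF \<open>e > 0\<close>]] .
    then obtain n where n: "\<bar>p n (x M)\<bar> < e/2" unfolding eventually_sequentially by blast
    define N where "N = max M (Suc n)"
    have "p n (\<lambda>l. x N l - x M l) = p n (x N) - p n (x M)" by (rule diff[OF x(1) x(1)])
    moreover have "e \<le> p n (x N)" by (rule x(3)) (simp add: N_def)
    ultimately have "e/2 \<le> p n (\<lambda>l. x N l - x M l)" using n by linarith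
    moreover have "\<bar>x N l - x M l\<bar> \<le> 2 * K" for l using x(2)[of N l] x(2)[of M l] by linarith
    ultimately show ?thesis
      using null_fun_diff[OF ideal x(1)[of N] x(1)[of M]] M[of N]
      by (intro exI[of _ "\<lambda>l. x N l - x M l"] exI[of _ n]) (simp add: N_def)
  qed
  then obtain z \<nu> where z: "\<And>k. z k \<in> null_fun J" "\<And>k l. \<bar>z k l\<bar> \<le> 2 * K"
      "\<And>k. control (\<lambda>l. (z k l)\<^sup>2) \<le> d\<^sup>2 * (1/2) ^ k" "\<And>k. e/2 \<le> p (\<nu> k) (z k)"
    by metis
  define E where "E k = {l. d \<le> \<bar>z k l\<bar>}" for k
  have E: "E k \<in> J" for k using z(1)[of k] d(1) by (simp add: E_def null_fun_def)
  have ind: "indicator (E k) \<in> null_fun J" for k using E by (simp add: null_fun_indicator[OF ideal])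
  show False
  proof (rule no_concentration[OF exh E])
    show "0 < e / (8 * K)" using \<open>e > 0\<close> \<open>K > 0\<close> by simp
    fix k
    \<comment> \<open>Chebyshev's inequality\<close>
    show "variation n (E k) \<le> 2 ^ n * (1/2) ^ k" for n
    proof -
      have sq: "(\<lambda>l. (z k l)\<^sup>2) \<in> null_fun J" by (rule null_fun_square[OF ideal z(1)])
      have "variation n (E k) \<le> absval (p n) (\<lambda>l. (1 / d\<^sup>2) * (z k l)\<^sup>2)"
      proof (rule absval_mono[OF null_fun_scale[OF ideal sq]])
        show "indicator (E k) l \<le> (1 / d\<^sup>2) * (z k l)\<^sup>2" for l
        proof (cases "l \<in> E k")
          case True
          then have "d\<^sup>2 \<le> (z k l)\<^sup>2" using d(1) by (simp add: E_def abs_le_square_iff[symmetric])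
          then show ?thesis using True d(1) by simp
        qed simp
      qed simp
      also have "\<dots> \<le> (1 / d\<^sup>2) * absval (p n) (\<lambda>l. (z k l)\<^sup>2)"
        using d(1) by (intro absval_scale_le sq) auto
      also have "\<dots> \<le> (1 / d\<^sup>2) * (2 ^ n * (d\<^sup>2 * (1/2) ^ k))"
      proof (rule mult_left_mono)
        have "absval (p n) (\<lambda>l. (z k l)\<^sup>2) \<le> 2 ^ n * control (\<lambda>l. (z k l)\<^sup>2)"
          by (rule absval_le_control[OF sq]) simp
        also have "\<dots> \<le> 2 ^ n * (d\<^sup>2 * (1/2) ^ k)" using z(3) by (intro mult_left_mono) auto
        finally show "absval (p n) (\<lambda>l. (z k l)\<^sup>2) \<le> 2 ^ n * (d\<^sup>2 * (1/2) ^ k)" .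
      qed simp
      also have "\<dots> = 2 ^ n * (1/2) ^ k" using d(1) by simp
      finally show ?thesis .
    qed
    show "e / (8 * K) \<le> variation (\<nu> k) (E k)"
    proof -
      define a where "a l = \<bar>z k l\<bar> * indicator (E k) l" for l
      define b where "b l = \<bar>z k l\<bar> * indicator (- E k) l" for l
      have ab: "a \<in> null_fun J" "b \<in> null_fun J"
        by (auto intro!: null_fun_solid[OF ideal z(1)[of k]] simp: a_def b_def indicator_def)
      have nonneg: "0 \<le> a l" "0 \<le> b l" for l by (simp_all add: a_def b_def)
      have dec: "(\<lambda>l. a l + b l) = (\<lambda>l. \<bar>z k l\<bar>)" by (auto simp: a_def b_def indicator_def)
      have "e/2 \<le> \<bar>p (\<nu> k) (z k)\<bar>" using z(4)[of k] by simp
      also have "\<dots> \<le> absval (p (\<nu> k)) (\<lambda>l. a l + b l)"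
        by (rule le_absval[OF null_fun_add[OF ideal ab]]) (simp add: fun_cong[OF dec])
      also have "\<dots> = absval (p (\<nu> k)) a + absval (p (\<nu> k)) b" by (rule absval_add[OF ab(1) nonneg(1) ab(2) nonneg(2)])
      also have "absval (p (\<nu> k)) b \<le> R * d"
        by (rule absval_le_bound[OF ab(2) nonneg(2)]) (use d in \<open>auto simp: b_def E_def indicator_def\<close>)
      also have "absval (p (\<nu> k)) a \<le> absval (p (\<nu> k)) (\<lambda>l. 2 * K * indicator (E k) l)"
        by (rule absval_mono[OF null_fun_scale[OF ideal ind] nonneg(1)])
          (use z(2)[of k] in \<open>auto simp: a_def indicator_def\<close>)
      also have "\<dots> \<le> 2 * K * variation (\<nu> k) (E k)"
        using \<open>K > 0\<close> by (intro absval_scale_le ind) auto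
      finally have "e/4 \<le> 2 * K * variation (\<nu> k) (E k)" using d(2) by linarith
      then show ?thesis using \<open>K > 0\<close> by (simp add: field_simps)
    qed
  qed
qed

end

section \<open>Duals of subspaces\<close>

lemma dual_on_add: "f \<in> dual_on X \<Longrightarrow> x \<in> X \<Longrightarrow> y \<in> X \<Longrightarrow> f (x + y) = f x + f y"
  and dual_on_scale: "f \<in> dual_on X \<Longrightarrow> x \<in> X \<Longrightarrow> f (c *\<^sub>R x) = c * f x"
  and dual_on_bounded: "f \<in> dual_on X \<Longrightarrow> \<exists>K. \<forall>x\<in>X. \<bar>f x\<bar> \<le> K * norm x"
  by (simp_all add: dual_on_def)

lemma dual_on_diff:
  assumes "subspace X" "f \<in> dual_on X" "x \<in> X" "y \<in> X"
  shows "f (x - y) = f x - f y"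
  using dual_on_add[OF assms(2,3), of "-1 *\<^sub>R y"] dual_on_scale[OF assms(2,4), of "-1"]
    subspace_scale[OF assms(1,4), of "-1"] by simp

lemma dual_on_zero:
  assumes "subspace X" "f \<in> dual_on X"
  shows "f 0 = 0"
  using dual_on_diff[OF assms subspace_0 subspace_0] assms by simp

lemma dual_on_linear_combination:
  assumes "f \<in> dual_on X" "g \<in> dual_on X"
  shows "(\<lambda>x. f x + c * g x) \<in> dual_on X"
proof -
  obtain K L where K: "\<forall>x\<in>X. \<bar>f x\<bar> \<le> K * norm x" and L: "\<forall>x\<in>X. \<bar>g x\<bar> \<le> L * norm x"
    using assms dual_on_bounded by blast
  have "\<bar>f x + c * g x\<bar> \<le> (K + \<bar>c\<bar> * L) * norm x" if "x \<in> X" for x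
  proof -
    have "\<bar>f x + c * g x\<bar> \<le> \<bar>f x\<bar> + \<bar>c\<bar> * \<bar>g x\<bar>"
      using abs_triangle_ineq[of "f x" "c * g x"] by (simp add: abs_mult)
    also have "\<dots> \<le> K * norm x + \<bar>c\<bar> * (L * norm x)"
      using K L that by (intro add_mono mult_left_mono) auto
    finally show ?thesis by (simp add: algebra_simps)
  qed
  then have "\<exists>M. \<forall>x\<in>X. \<bar>f x + c * g x\<bar> \<le> M * norm x" by blast
  moreover have "\<forall>x\<in>X. \<forall>y\<in>X. f (x + y) + c * g (x + y) = f x + c * g x + (f y + c * g y)"
    "\<forall>x\<in>X. \<forall>d. f (d *\<^sub>R x) + c * g (d *\<^sub>R x) = d * (f x + c * g x)"
    "\<forall>x. x \<notin> X \<longrightarrow> f x + c * g x = 0"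
    using assms by (simp_all add: dual_on_def algebra_simps)
  ultimately show ?thesis unfolding dual_on_def by blast
qed

lemma dual_on_scaled: "f \<in> dual_on X \<Longrightarrow> (\<lambda>x. c * f x) \<in> dual_on X"
proof -
  assume f: "f \<in> dual_on X"
  have "(\<lambda>x. f x + (c - 1) * f x) \<in> dual_on X" by (rule dual_on_linear_combination[OF f f])
  then show ?thesis by (simp add: algebra_simps)
qed

lemma dual_norm_on_bdd:
  assumes "f \<in> dual_on X"
  shows "bdd_above ((\<lambda>x. \<bar>f x\<bar>) ` {x \<in> X. norm x \<le> 1})"
proof -
  obtain K where K: "\<forall>x\<in>X. \<bar>f x\<bar> \<le> K * norm x" using assms dual_on_bounded by blast
  have "\<bar>f x\<bar> \<le> \<bar>K\<bar>" if "x \<in> X" "norm x \<le> 1" for x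
  proof -
    have "\<bar>f x\<bar> \<le> K * norm x" using K that by blast
    also have "\<dots> \<le> \<bar>K\<bar> * 1" using that by (intro mult_mono) auto
    finally show ?thesis by simp
  qed
  then show ?thesis by (intro bdd_aboveI[of _ "\<bar>K\<bar>"]) auto
qed

lemma dual_norm_on_upper: "f \<in> dual_on X \<Longrightarrow> x \<in> X \<Longrightarrow> norm x \<le> 1 \<Longrightarrow> \<bar>f x\<bar> \<le> dual_norm_on X f"
  unfolding dual_norm_on_def by (rule cSUP_upper[OF _ dual_norm_on_bdd]) auto

lemma dual_norm_on_nonneg:
  assumes "subspace X" "f \<in> dual_on X"
  shows "0 \<le> dual_norm_on X f"
  using dual_norm_on_upper[OF assms(2) subspace_0[OF assms(1)]] by simp

lemma dual_norm_on_approx: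
  assumes "subspace X" "c < dual_norm_on X f"
  obtains x where "x \<in> X" "norm x \<le> 1" "c < \<bar>f x\<bar>"
proof -
  have "\<not> (\<forall>x\<in>{x \<in> X. norm x \<le> 1}. \<bar>f x\<bar> \<le> c)"
  proof
    assume "\<forall>x\<in>{x \<in> X. norm x \<le> 1}. \<bar>f x\<bar> \<le> c"
    then have "dual_norm_on X f \<le> c"
      unfolding dual_norm_on_def using subspace_0[OF assms(1)] by (intro cSUP_least) auto
    then show False using assms(2) by simp
  qed
  then show ?thesis using that by force
qed

lemma dual_norm_on_bound:
  assumes "subspace X" "f \<in> dual_on X" "x \<in> X"
  shows "\<bar>f x\<bar> \<le> dual_norm_on X f * norm x"
proof (cases "x = 0")
  case True
  then show ?thesis using dual_on_zero[OF assms(1,2)] by simp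
next
  case False
  have "\<bar>f ((1 / norm x) *\<^sub>R x)\<bar> \<le> dual_norm_on X f"
    using False assms by (intro dual_norm_on_upper subspace_scale) auto
  then show ?thesis using False dual_on_scale[OF assms(2,3)] by (simp add: abs_mult field_simps)
qed

text \<open>The uniform boundedness principle, by a gliding hump: with almost norming vectors \<open>u k\<close> the
  series of \<open>\<plusminus> (1/3) ^ k *\<^sub>R u k\<close> can be signed so that its sum is sent far away from \<open>0\<close>.\<close>

lemma weak_star_null_on_bounded:
  fixes X :: "'a::real_normed_vector set"
  assumes X: "subspace X" "complete X" and \<phi>: "\<And>n. \<phi> n \<in> dual_on X" and null: "weak_star_null_on X \<phi>"
  obtains R where "\<And>n x. x \<in> X \<Longrightarrow> \<bar>\<phi> n x\<bar> \<le> R * norm x"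
proof -
  have "\<exists>R. \<forall>n. dual_norm_on X (\<phi> n) \<le> R"
  proof (rule ccontr)
    assume "\<not> ?thesis"
    then have "\<forall>k. \<exists>n. 4 ^ k < dual_norm_on X (\<phi> n)" by (meson not_le)
    then obtain n where n: "\<And>k :: nat. 4 ^ k < dual_norm_on X (\<phi> (n k))" by metis
    define c where "c k = dual_norm_on X (\<phi> (n k))" for k
    have c: "4 ^ k < c k" "0 < c k" for k
      unfolding c_def using n[of k] less_trans[OF zero_less_power n[of k]] by simp_all
    have "\<exists>u. u \<in> X \<and> norm u \<le> 1 \<and> 2/3 * c k < \<bar>\<phi> (n k) u\<bar>" for k
      using dual_norm_on_approx[OF X(1), of "2/3 * c k" "\<phi> (n k)"] c(2)[of k] unfolding c_def by force
    then obtain u where u: "\<And>k. u k \<in> X" "\<And>k. norm (u k) \<le> 1" "\<And>k. 2/3 * c k < \<bar>\<phi> (n k) (u k)\<bar>"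
      by metis
    define w where "w k = ((1/3) ^ k :: real) *\<^sub>R u k" for k
    have w: "w k \<in> X" for k unfolding w_def by (rule subspace_scale[OF X(1) u(1)])
    define x where "x = rec_nat 0 (\<lambda>k y. if \<bar>\<phi> (n k) (w k)\<bar> \<le> \<bar>\<phi> (n k) (y + w k)\<bar> then y + w k else y - w k)"
    have x_Suc: "x (Suc k) = (if \<bar>\<phi> (n k) (w k)\<bar> \<le> \<bar>\<phi> (n k) (x k + w k)\<bar> then x k + w k else x k - w k)" for k
      by (simp add: x_def)
    have xX: "x k \<in> X" for k
    proof (induction k)
      case 0
      then show ?case using subspace_0[OF X(1)] by (simp add: x_def)
    next
      case (Suc k)
      then show ?case using w by (simp add: x_Suc subspace_add[OF X(1)] subspace_diff[OF X(1)])
    qed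
    have hump: "\<bar>\<phi> (n k) (w k)\<bar> \<le> \<bar>\<phi> (n k) (x (Suc k))\<bar>" for k
    proof (cases "\<bar>\<phi> (n k) (w k)\<bar> \<le> \<bar>\<phi> (n k) (x k + w k)\<bar>")
      case False
      then show ?thesis
        using dual_on_add[OF \<phi> xX w] dual_on_diff[OF X(1) \<phi> xX w] by (simp add: x_Suc)
    qed (simp add: x_Suc)
    have norm_step: "norm (x (Suc k) - x k) \<le> (1/3) ^ k" for k
    proof -
      have "norm (x (Suc k) - x k) = norm (w k)" by (simp add: x_Suc)
      also have "\<dots> \<le> (1/3) ^ k * 1" using u(2)[of k] by (simp add: w_def mult_left_le power_divide divide_right_mono)
      finally show ?thesis by simp
    qed
    have tail: "norm (x (k + m) - x k) \<le> 3/2 * (1/3) ^ k * (1 - (1/3) ^ m)" for k m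
    proof (induction m)
      case (Suc m)
      have "norm (x (k + Suc m) - x k) \<le> norm (x (Suc (k + m)) - x (k + m)) + norm (x (k + m) - x k)"
        using norm_triangle_ineq[of "x (Suc (k + m)) - x (k + m)" "x (k + m) - x k"] by simp
      also have "\<dots> \<le> (1/3) ^ (k + m) + 3/2 * (1/3) ^ k * (1 - (1/3) ^ m)"
        by (rule add_mono[OF norm_step Suc.IH])
      also have "\<dots> = 3/2 * (1/3) ^ k * (1 - (1/3) ^ Suc m)" by (simp add: power_add field_simps)
      finally show ?case .
    qed simp
    have tail': "norm (x m - x k) \<le> 3/2 * (1/3) ^ k" if "k \<le> m" for k m
    proof -
      have "3/2 * (1/3) ^ k * (1 - (1/3) ^ (m - k)) \<le> 3/2 * (1/3 :: real) ^ k * 1"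
        by (intro mult_left_mono) auto
      moreover have "norm (x m - x k) \<le> 3/2 * (1/3) ^ k * (1 - (1/3) ^ (m - k))"
        using tail[of k "m - k"] that by simp
      ultimately show ?thesis by linarith
    qed
    have "Cauchy x"
    proof (rule metric_CauchyI)
      fix e :: real assume "e > 0"
      then obtain N where N: "(1/3) ^ N < e / 3" using real_arch_pow_inv[of "e/3" "1/3"] by auto
      have "dist (x i) (x j) < e" if "N \<le> i" "N \<le> j" for i j
      proof -
        have "dist (x i) (x j) \<le> norm (x i - x N) + norm (x j - x N)"
          using dist_triangle2[of "x i" "x j" "x N"] by (simp add: dist_norm)
        also have "\<dots> \<le> 3 * (1/3) ^ N" using tail'[OF that(1)] tail'[OF that(2)] by simp
        also have "\<dots> < e" using N by simp
        finally show ?thesis .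
      qed
      then show "\<exists>M. \<forall>m\<ge>M. \<forall>n\<ge>M. dist (x m) (x n) < e" by blast
    qed
    then obtain y where yX: "y \<in> X" and y: "x \<longlonglongrightarrow> y"
      using X(2) xX unfolding complete_def by blast
    have y_tail: "norm (y - x (Suc k)) \<le> 1/2 * (1/3) ^ k" for k
    proof (rule LIMSEQ_le_const2)
      show "(\<lambda>m. norm (x m - x (Suc k))) \<longlonglongrightarrow> norm (y - x (Suc k))" by (intro tendsto_intros y)
      show "\<exists>N. \<forall>m\<ge>N. norm (x m - x (Suc k)) \<le> 1/2 * (1/3) ^ k"
        using tail'[of "Suc k"] by (intro exI[of _ "Suc k"]) simp
    qed
    have large: "1/6 * (4/3) ^ k \<le> \<bar>\<phi> (n k) y\<bar>" for k
    proof -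
      have "2/3 * c k * (1/3) ^ k \<le> \<bar>\<phi> (n k) (u k)\<bar> * (1/3) ^ k"
        using u(3)[of k] by (intro mult_right_mono) auto
      also have "\<dots> = \<bar>\<phi> (n k) (w k)\<bar>"
        unfolding w_def dual_on_scale[OF \<phi> u(1)] by (simp add: abs_mult)
      finally have 1: "2/3 * c k * (1/3) ^ k \<le> \<bar>\<phi> (n k) (x (Suc k))\<bar>" using hump[of k] by linarith
      have "\<bar>\<phi> (n k) (y - x (Suc k))\<bar> \<le> c k * norm (y - x (Suc k))"
        unfolding c_def using \<phi> yX xX subspace_diff[OF X(1)] by (intro dual_norm_on_bound X(1)) auto
      also have "\<dots> \<le> c k * (1/2 * (1/3) ^ k)" using c(2)[of k] y_tail by (intro mult_left_mono) auto
      finally have "\<bar>\<phi> (n k) y - \<phi> (n k) (x (Suc k))\<bar> \<le> 1/2 * (c k * (1/3) ^ k)"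
        unfolding dual_on_diff[OF X(1) \<phi> yX xX] by simp
      then have 2: "\<bar>\<phi> (n k) (x (Suc k))\<bar> - \<bar>\<phi> (n k) y\<bar> \<le> 1/2 * (c k * (1/3) ^ k)"
        by linarith
      have "(4::real) ^ k * (1/3) ^ k \<le> c k * (1/3) ^ k" using c(1)[of k] by (intro mult_right_mono) auto
      then have "(4/3) ^ k \<le> c k * (1/3) ^ k" by (simp add: power_mult_distrib[symmetric])
      then show ?thesis using 1 2 by linarith
    qed
    have "(\<lambda>m. \<phi> m y) \<longlonglongrightarrow> 0" using null yX by (simp add: weak_star_null_on_def)
    then have "Bseq (\<lambda>m. \<phi> m y)" by (meson convergent_def convergent_imp_Bseq)
    then obtain B where B: "\<And>m. \<bar>\<phi> m y\<bar> \<le> B" unfolding Bseq_def by auto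
    obtain k where "6 * B < (4/3) ^ k" using real_arch_pow[of "4/3" "6 * B"] by auto
    then show False using large[of k] B[of "n k"] by linarith
  qed
  then obtain R where R: "\<And>n. dual_norm_on X (\<phi> n) \<le> R" by blast
  show ?thesis
  proof
    fix n x assume "x \<in> X"
    then have "\<bar>\<phi> n x\<bar> \<le> dual_norm_on X (\<phi> n) * norm x" by (rule dual_norm_on_bound[OF X(1) \<phi>])
    also have "\<dots> \<le> R * norm x" using R by (intro mult_right_mono) auto
    finally show "\<bar>\<phi> n x\<bar> \<le> R * norm x" .
  qed
qed

lemma bidual_on_add: "\<Phi> \<in> bidual_on X \<Longrightarrow> f \<in> dual_on X \<Longrightarrow> g \<in> dual_on X \<Longrightarrow>
    \<Phi> (\<lambda>x. f x + g x) = \<Phi> f + \<Phi> g"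
  and bidual_on_scale: "\<Phi> \<in> bidual_on X \<Longrightarrow> f \<in> dual_on X \<Longrightarrow> \<Phi> (\<lambda>x. c * f x) = c * \<Phi> f"
  by (simp_all add: bidual_on_def)

lemma bidual_on_sum:
  fixes N :: nat
  assumes \<Phi>: "\<Phi> \<in> bidual_on X" and \<psi>: "\<And>i. \<psi> i \<in> dual_on X"
  shows "(\<lambda>x. \<Sum>i<N. c i * \<psi> i x) \<in> dual_on X \<and> \<Phi> (\<lambda>x. \<Sum>i<N. c i * \<psi> i x) = (\<Sum>i<N. c i * \<Phi> (\<psi> i))"
proof (induction N)
  case 0
  have z: "(\<lambda>x. 0 * \<psi> 0 x) \<in> dual_on X" by (rule dual_on_scaled[OF \<psi>])
  have "\<Phi> (\<lambda>x. 0 * \<psi> 0 x) = 0 * \<Phi> (\<psi> 0)" by (rule bidual_on_scale[OF \<Phi> \<psi>])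
  then show ?case using z by simp
next
  case (Suc N)
  let ?f = "\<lambda>x. \<Sum>i<N. c i * \<psi> i x"
  have g: "(\<lambda>x. c N * \<psi> N x) \<in> dual_on X" by (rule dual_on_scaled[OF \<psi>])
  have "\<Phi> (\<lambda>x. ?f x + c N * \<psi> N x) = \<Phi> ?f + \<Phi> (\<lambda>x. c N * \<psi> N x)"
    using bidual_on_add[OF \<Phi> _ g, of ?f] Suc by simp
  also have "\<Phi> (\<lambda>x. c N * \<psi> N x) = c N * \<Phi> (\<psi> N)"
    by (rule bidual_on_scale[OF \<Phi> \<psi>])
  finally show ?case using Suc dual_on_linear_combination[OF _ \<psi>] by simp
qed

text \<open>A form of Helly's theorem.  Minimise the convex penalty \<open>\<Sum>i<N. (max 0 (e - \<psi> i x))\<^sup>2\<close> over a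
  ball.  If its infimum were positive, then at an almost minimal point the functional
  with the coefficients \<open>max 0 (e - \<psi> i x)\<close>, on which the bidual element is large, provides
  a direction in which the penalty decreases below the infimum.\<close>

lemma bidual_on_positive_imp_common_positive:
  assumes X: "subspace X" and \<psi>: "\<And>i. \<psi> i \<in> dual_on X" and \<Phi>: "\<Phi> \<in> bidual_on X"
    and "e > 0" and pos: "\<And>i. e \<le> \<Phi> (\<psi> i)"
  obtains K where "K > 0" "\<And>N :: nat. \<exists>x\<in>X. norm x \<le> K \<and> (\<forall>i<N. e/2 \<le> \<psi> i x)"
proof -
  obtain K0 where K0: "\<And>f. f \<in> dual_on X \<Longrightarrow> \<bar>\<Phi> f\<bar> \<le> K0 * dual_norm_on X f"
    using \<Phi> unfolding bidual_on_def by blast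
  define K where "K = max K0 1"
  have K: "\<bar>\<Phi> f\<bar> \<le> K * dual_norm_on X f" if "f \<in> dual_on X" for f
  proof -
    have "K0 * dual_norm_on X f \<le> K * dual_norm_on X f"
      using dual_norm_on_nonneg[OF X that] by (intro mult_right_mono) (auto simp: K_def)
    then show ?thesis using K0[OF that] by simp
  qed
  have K_pos: "K > 0" by (simp add: K_def)
  have direction: "\<exists>y\<in>X. norm y \<le> K \<and> e * (\<Sum>i<N. c i) - \<eta> < (\<Sum>i<N. c i * \<psi> i y)"
    if "\<And>i. 0 \<le> c i" "\<eta> > 0" for c \<eta> and N :: nat
  proof -
    define f where "f x = (\<Sum>i<N. c i * \<psi> i x)" for x
    have f: "f \<in> dual_on X" "\<Phi> f = (\<Sum>i<N. c i * \<Phi> (\<psi> i))"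
      using bidual_on_sum[where \<psi> = \<psi> and N = N and c = c, OF \<Phi> \<psi>] unfolding f_def by simp_all
    have "e * (\<Sum>i<N. c i) \<le> \<Phi> f"
      unfolding f(2) sum_distrib_left
      by (intro sum_mono) (use mult_left_mono[OF pos that(1)] in \<open>simp add: mult.commute\<close>)
    also have "\<dots> \<le> K * dual_norm_on X f" using K[OF f(1)] by simp
    finally have "(e * (\<Sum>i<N. c i) - \<eta>) / K < dual_norm_on X f"
      using K_pos \<open>\<eta> > 0\<close> by (simp add: field_simps)
    then obtain u where u: "u \<in> X" "norm u \<le> 1" "(e * (\<Sum>i<N. c i) - \<eta>) / K < \<bar>f u\<bar>"
      by (rule dual_norm_on_approx[OF X])
    define y where "y = (K * (if f u < 0 then -1 else 1)) *\<^sub>R u"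
    have "f y = K * \<bar>f u\<bar>" unfolding y_def dual_on_scale[OF f(1) u(1)] by simp
    then have "e * (\<Sum>i<N. c i) - \<eta> < f y" using u(3) K_pos by (simp add: field_simps)
    moreover have "norm y \<le> K" using u(2) K_pos by (simp add: y_def abs_mult mult_left_le)
    moreover have "y \<in> X" unfolding y_def by (rule subspace_scale[OF X u(1)])
    ultimately show ?thesis unfolding f_def by blast
  qed
  have "\<exists>x\<in>X. norm x \<le> K \<and> (\<forall>i<N. e/2 \<le> \<psi> i x)" for N :: nat
  proof -
    define Q where "Q = {x\<in>X. norm x \<le> K}"
    define F where "F x = (\<Sum>i<N. (max 0 (e - \<psi> i x))\<^sup>2)" for x
    define m where "m = (INF x\<in>Q. F x)"
    have Q_ne: "Q \<noteq> {}" using subspace_0[OF X] K_pos by (auto simp: Q_def)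
    have bdd: "bdd_below (F ` Q)" by (intro bdd_belowI[of _ 0]) (auto simp: F_def sum_nonneg)
    have m_le: "m \<le> F x" if "x \<in> Q" for x unfolding m_def by (rule cINF_lower[OF bdd that])
    have "m \<le> 0"
    proof (rule ccontr)
      assume "\<not> m \<le> 0"
      then have m: "m > 0" by simp
      define L where "L = (\<Sum>i<N. (dual_norm_on X (\<psi> i) * (2 * K))\<^sup>2) + 1"
      have L: "L > 0" unfolding L_def by (intro add_nonneg_pos sum_nonneg) auto
      define t where "t = min 1 (m / (2 * L))"
      have t: "0 < t" "t \<le> 1" "t * L \<le> m / 2"
      proof -
        have "t * L \<le> m / (2 * L) * L" using L by (intro mult_right_mono) (auto simp: t_def)
        then show "t * L \<le> m / 2" using L by simp
      qed (use m L in \<open>auto simp: t_def\<close>)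
      obtain x where x: "x \<in> Q" "F x < m + t * m / 4"
        using cINF_less_iff[OF Q_ne bdd, of "m + t * m / 4"] t(1) m unfolding m_def by auto
      define c where "c i = max 0 (e - \<psi> i x)" for i
      obtain y where y: "y \<in> X" "norm y \<le> K" "e * (\<Sum>i<N. c i) - m/2 < (\<Sum>i<N. c i * \<psi> i y)"
        using direction[of c "m/2" N] m by (auto simp: c_def)
      have xX: "x \<in> X" "norm x \<le> K" using x(1) by (auto simp: Q_def)
      define v where "v i = \<psi> i y - \<psi> i x" for i
      define z where "z = x + t *\<^sub>R (y - x)"
      have z: "z \<in> Q"
      proof -
        have "z = (1 - t) *\<^sub>R x + t *\<^sub>R y" by (simp add: z_def algebra_simps)
        then have "norm z \<le> (1 - t) * norm x + t * norm y"
          using norm_triangle_ineq[of "(1 - t) *\<^sub>R x" "t *\<^sub>R y"] t(1,2) by simp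
        also have "\<dots> \<le> (1 - t) * K + t * K"
          using t(1,2) xX(2) y(2) by (intro add_mono mult_left_mono) auto
        finally have "norm z \<le> K" by (simp add: algebra_simps)
        moreover have "z \<in> X" unfolding z_def
          by (intro subspace_add[OF X] subspace_scale[OF X] subspace_diff[OF X] xX y)
        ultimately show ?thesis by (simp add: Q_def)
      qed
      have \<psi>z: "\<psi> i z = \<psi> i x + t * v i" for i
        unfolding z_def v_def
        using dual_on_add[OF \<psi> xX(1) subspace_scale[OF X subspace_diff[OF X y(1) xX(1)]]]
          dual_on_scale[OF \<psi> subspace_diff[OF X y(1) xX(1)]] dual_on_diff[OF X \<psi> y(1) xX(1)] by simp
      have v_le: "(v i)\<^sup>2 \<le> (dual_norm_on X (\<psi> i) * (2 * K))\<^sup>2" for i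
      proof -
        have "\<bar>v i\<bar> \<le> dual_norm_on X (\<psi> i) * norm (y - x)"
          unfolding v_def dual_on_diff[OF X \<psi> y(1) xX(1), symmetric]
          by (rule dual_norm_on_bound[OF X \<psi> subspace_diff[OF X y(1) xX(1)]])
        also have "\<dots> \<le> dual_norm_on X (\<psi> i) * (2 * K)"
          using norm_triangle_ineq4[of y x] y(2) xX(2)
          by (intro mult_left_mono dual_norm_on_nonneg X \<psi>) auto
        finally show ?thesis by (rule abs_le_square_iff[THEN iffD1, OF order_trans[OF _ abs_ge_self]])
      qed
      have pointwise: "(max 0 (a - t * b))\<^sup>2 \<le> (max 0 a)\<^sup>2 - 2 * t * (max 0 a * b) + t\<^sup>2 * b\<^sup>2" for a b
      proof -
        have "\<bar>max 0 (a - t * b)\<bar> \<le> \<bar>max 0 a - t * b\<bar>" by (auto simp: max_def)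
        then have "(max 0 (a - t * b))\<^sup>2 \<le> (max 0 a - t * b)\<^sup>2" unfolding abs_le_square_iff .
        then show ?thesis by (simp add: power2_eq_square algebra_simps)
      qed
      have "F z \<le> (\<Sum>i<N. (c i)\<^sup>2 - 2 * t * (c i * v i) + t\<^sup>2 * (v i)\<^sup>2)"
        unfolding F_def \<psi>z
        by (intro sum_mono) (use pointwise[of "e - \<psi> _ x" "v _"] in \<open>simp add: c_def algebra_simps\<close>)
      also have "\<dots> = F x - 2 * t * (\<Sum>i<N. c i * v i) + t\<^sup>2 * (\<Sum>i<N. (v i)\<^sup>2)"
        by (simp add: F_def c_def sum.distrib sum_subtractf sum_distrib_left)
      also have "t\<^sup>2 * (\<Sum>i<N. (v i)\<^sup>2) \<le> t * (t * L)"
      proof -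
        have "(\<Sum>i<N. (v i)\<^sup>2) \<le> L" unfolding L_def
          using sum_mono[of "{..<N}" "\<lambda>i. (v i)\<^sup>2"] v_le by (meson add_increasing2 zero_le_one)
        then show ?thesis using t(1) by (simp add: power2_eq_square)
      qed
      also have "\<dots> \<le> t * (m / 2)" using t by (intro mult_left_mono) auto
      finally have Fz: "F z \<le> F x - 2 * t * (\<Sum>i<N. c i * v i) + t * (m / 2)" by simp
      have "(\<Sum>i<N. c i * v i) = (\<Sum>i<N. c i * \<psi> i y) - (\<Sum>i<N. c i * \<psi> i x)"
        by (simp add: v_def sum_subtractf algebra_simps)
      moreover have "e * (\<Sum>i<N. c i) - (\<Sum>i<N. c i * \<psi> i x) = F x"
        unfolding F_def sum_distrib_left sum_subtractf[symmetric]
        by (intro sum.cong refl) (auto simp: c_def max_def power2_eq_square algebra_simps)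
      ultimately have "m / 2 \<le> (\<Sum>i<N. c i * v i)" using y(3) m_le[OF x(1)] by linarith
      then have "2 * t * (m / 2) \<le> 2 * t * (\<Sum>i<N. c i * v i)" using t(1) by (intro mult_left_mono) auto
      then have "F z \<le> F x - t * m / 2" using Fz by (simp add: algebra_simps)
      also have "\<dots> < m"
      proof -
        have "0 < t * m" using t(1) m by simp
        then show ?thesis using x(2) by linarith
      qed
      finally show False using m_le[OF z] by simp
    qed
    then have "m < (e/2)\<^sup>2" using \<open>e > 0\<close> by (meson half_gt_zero le_less_trans zero_less_power)
    then obtain x where x: "x \<in> Q" "F x < (e/2)\<^sup>2"
      using cINF_less_iff[OF Q_ne bdd] unfolding m_def by blast
    have "e/2 \<le> \<psi> i x" if "i < N" for i
    proof -
      have "(max 0 (e - \<psi> i x))\<^sup>2 \<le> F x" unfolding F_def using that by (intro member_le_sum) auto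
      then have "(max 0 (e - \<psi> i x))\<^sup>2 < (e/2)\<^sup>2" using x(2) by simp
      then have "max 0 (e - \<psi> i x) < e/2" using \<open>e > 0\<close> power_less_imp_less_base by fastforce
      then show ?thesis using max.cobounded2[of "e - \<psi> i x" 0] by linarith
    qed
    then show ?thesis using x(1) by (auto simp: Q_def)
  qed
  then show ?thesis using that K_pos by blast
qed

section \<open>Grothendieck ideals\<close>

lemma apply_Bcontfun_bounded:
  fixes f :: "nat \<Rightarrow> real"
  assumes "bounded (range f)"
  shows "apply_bcontfun (Bcontfun f) = f"
proof (rule Bcontfun_inverse)
  show "f \<in> bcontfun"
    using assms by (simp add: bcontfun_def continuous_on_discrete)
qed

lemma apply_bcontfun_mem_null_fun: "apply_bcontfun x \<in> null_fun J \<longleftrightarrow> x \<in> c0_ideal J"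
proof -
  have "bounded (range (apply_bcontfun x))"
    by (rule boundedI[of _ "norm x"]) (use norm_bounded[of x] in auto)
  then show ?thesis by (auto simp: null_fun_def c0_ideal_def)
qed

lemma apply_Bcontfun_null_fun: "f \<in> null_fun J \<Longrightarrow> apply_bcontfun (Bcontfun f) = f"
  by (simp add: null_fun_def apply_Bcontfun_bounded)

lemma Bcontfun_mem_c0_ideal: "f \<in> null_fun J \<Longrightarrow> Bcontfun f \<in> c0_ideal J"
  by (simp add: apply_bcontfun_mem_null_fun[symmetric] apply_Bcontfun_null_fun)

lemma complete_bcontfun_nat: "complete (UNIV :: (nat \<Rightarrow>\<^sub>C real) set)"
  unfolding complete_def
proof (intro allI impI, elim conjE)
  fix f :: "nat \<Rightarrow> nat \<Rightarrow>\<^sub>C real"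
  assume "Cauchy f"
  then obtain g where "uniform_limit UNIV (\<lambda>n. apply_bcontfun (f n)) g sequentially"
    using uniformly_convergent_eq_cauchy[of "\<lambda>_. True" "\<lambda>n. apply_bcontfun (f n)"]
    unfolding Cauchy_def uniform_limit_sequentially_iff by (metis dist_fun_lt_imp_dist_val_lt)
  then obtain l where "f \<longlonglongrightarrow> l"
    by (rule uniform_limit_bcontfunE[OF _ sequentially_bot])
  then show "\<exists>l\<in>UNIV. f \<longlonglongrightarrow> l" by blast
qed

lemma complete_c0_ideal: "omega_ideal J \<Longrightarrow> complete (c0_ideal J)"
  using complete_Int_closed[OF complete_bcontfun_nat closed_c0_ideal] by simp

lemma dual_on_c0_ideal_bdd_functional:
  assumes J: "omega_ideal J" and \<phi>: "\<phi> \<in> dual_on (c0_ideal J)"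
    and R: "\<And>x. x \<in> c0_ideal J \<Longrightarrow> \<bar>\<phi> x\<bar> \<le> R * norm x" "0 \<le> R"
  shows "bdd_functional J R (\<lambda>f. \<phi> (Bcontfun f))"
proof (rule bdd_functional.intro[OF J])
  fix f g :: "nat \<Rightarrow> real" and c B :: real
  assume f: "f \<in> null_fun J"
  have cf: "(\<lambda>n. c * f n) \<in> null_fun J" by (rule null_fun_scale[OF J f])
  have "Bcontfun (\<lambda>n. c * f n) = c *\<^sub>R Bcontfun f"
    by (rule bcontfun_eqI) (simp add: apply_Bcontfun_null_fun[OF f] apply_Bcontfun_null_fun[OF cf])
  then show "\<phi> (Bcontfun (\<lambda>n. c * f n)) = c * \<phi> (Bcontfun f)"
    using dual_on_scale[OF \<phi> Bcontfun_mem_c0_ideal[OF f]] by simp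
  show "\<phi> (Bcontfun (\<lambda>n. f n + g n)) = \<phi> (Bcontfun f) + \<phi> (Bcontfun g)" if g: "g \<in> null_fun J"
  proof -
    have fg: "(\<lambda>n. f n + g n) \<in> null_fun J" by (rule null_fun_add[OF J f g])
    have "Bcontfun (\<lambda>n. f n + g n) = Bcontfun f + Bcontfun g"
      by (rule bcontfun_eqI)
        (simp add: apply_Bcontfun_null_fun[OF f] apply_Bcontfun_null_fun[OF g] apply_Bcontfun_null_fun[OF fg])
    then show ?thesis
      using dual_on_add[OF \<phi> Bcontfun_mem_c0_ideal[OF f] Bcontfun_mem_c0_ideal[OF g]] by simp
  qed
  show "\<bar>\<phi> (Bcontfun f)\<bar> \<le> R * B" if "\<And>n. \<bar>f n\<bar> \<le> B"
  proof -
    have "norm (Bcontfun f) \<le> B"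
      by (rule norm_bound) (simp add: apply_Bcontfun_null_fun[OF f] that)
    then have "R * norm (Bcontfun f) \<le> R * B" using R(2) by (rule mult_left_mono)
    then show ?thesis using R(1)[OF Bcontfun_mem_c0_ideal[OF f]] by linarith
  qed
qed

text \<open>If a bidual element does not tend to \<open>0\<close> along a weak* null sequence, it is bounded away from
  \<open>0\<close>, with constant sign, along a subsequence; by Helly's theorem this bound is visible on
  bounded subsets of \<^term>\<open>c0_ideal J\<close>, where exhaustiveness excludes it.\<close>

lemma exhaustive_imp_grothendieck_ideal:
  assumes J: "omega_ideal J"
    and exh: "\<And>R p. bdd_functional_seq J R p \<Longrightarrow> bdd_functional_seq.exhaustive J p"
  shows "grothendieck_ideal J"
  unfolding grothendieck_ideal_def grothendieck_on_def weakly_null_dual_on_def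
proof (intro allI impI ballI)
  let ?X = "c0_ideal J"
  have X: "subspace ?X" "complete ?X" by (rule subspace_c0_ideal[OF J], rule complete_c0_ideal[OF J])
  fix \<phi> \<Phi> assume \<phi>: "\<forall>n. \<phi> n \<in> dual_on ?X" and null: "weak_star_null_on ?X \<phi>"
    and \<Phi>: "\<Phi> \<in> bidual_on ?X"
  show "(\<lambda>n. \<Phi> (\<phi> n)) \<longlonglongrightarrow> 0"
  proof (rule ccontr)
    assume "\<not> ?thesis"
    then obtain d where d: "d > 0" "infinite {n. d \<le> \<bar>\<Phi> (\<phi> n)\<bar>}" by (rule not_tendsto_zero_real)
    have "{n. d \<le> \<bar>\<Phi> (\<phi> n)\<bar>} = {n. d \<le> 1 * \<Phi> (\<phi> n)} \<union> {n. d \<le> -1 * \<Phi> (\<phi> n)}" by auto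
    then obtain s :: real where s: "infinite {n. d \<le> s * \<Phi> (\<phi> n)}" using d(2) by (metis finite_Un)
    define r where "r = enumerate {n. d \<le> s * \<Phi> (\<phi> n)}"
    have r: "strict_mono r" "\<And>i. d \<le> s * \<Phi> (\<phi> (r i))"
      using strict_mono_enumerate[OF s] enumerate_in_set[OF s] by (simp_all add: r_def)
    define \<psi> where "\<psi> i x = s * \<phi> (r i) x" for i x
    have \<psi>: "\<psi> i \<in> dual_on ?X" for i
      unfolding \<psi>_def[abs_def] using \<phi> by (intro dual_on_scaled) blast
    have \<psi>_null: "weak_star_null_on ?X \<psi>"
      unfolding weak_star_null_on_def
    proof
      fix x assume "x \<in> ?X"
      then have "(\<lambda>n. \<phi> n x) \<longlonglongrightarrow> 0" using null by (simp add: weak_star_null_on_def)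
      from tendsto_mult_right_zero[OF LIMSEQ_subseq_LIMSEQ[OF this r(1)], of s]
      show "(\<lambda>i. \<psi> i x) \<longlonglongrightarrow> 0" by (simp add: \<psi>_def o_def)
    qed
    have pos: "d \<le> \<Phi> (\<psi> i)" for i
      using bidual_on_scale[OF \<Phi>, of "\<phi> (r i)" s] \<phi> r(2)[of i] by (simp add: \<psi>_def[abs_def])
    obtain R0 where R0: "\<And>n x. x \<in> ?X \<Longrightarrow> \<bar>\<psi> n x\<bar> \<le> R0 * norm x"
      by (rule weak_star_null_on_bounded[where \<phi> = \<psi>, OF X \<psi> \<psi>_null]) (rule that)
    define R where "R = max R0 0"
    have R: "\<bar>\<psi> n x\<bar> \<le> R * norm x" if "x \<in> ?X" for n x
      using R0[OF that, of n] mult_right_mono[of R0 R "norm x"] by (simp add: R_def)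
    define p where "p n f = \<psi> n (Bcontfun f)" for n f
    have seq: "bdd_functional_seq J R p"
    proof (rule bdd_functional_seq.intro)
      show "bdd_functional J R (p k)" for k
        unfolding p_def[abs_def] by (rule dual_on_c0_ideal_bdd_functional[OF J \<psi> R]) (simp_all add: R_def)
      show "(\<lambda>k. p k f) \<longlonglongrightarrow> 0" if "f \<in> null_fun J" for f
        using \<psi>_null Bcontfun_mem_c0_ideal[OF that] by (simp add: p_def weak_star_null_on_def)
    qed
    interpret bdd_functional_seq J R p by (rule seq)
    obtain K where K: "K > 0" "\<And>N. \<exists>x\<in>?X. norm x \<le> K \<and> (\<forall>i<N. d/2 \<le> \<psi> i x)"
      using bidual_on_positive_imp_common_positive[where \<psi> = \<psi>, OF X(1) \<psi> \<Phi> d(1) pos] by blast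
    have "\<exists>f\<in>null_fun J. (\<forall>k. \<bar>f k\<bar> \<le> K) \<and> (\<forall>i<N. d/2 \<le> p i f)" for N
    proof -
      obtain x where x: "x \<in> ?X" "norm x \<le> K" "\<forall>i<N. d/2 \<le> \<psi> i x" using K(2) by blast
      have "\<bar>apply_bcontfun x k\<bar> \<le> K" for k using norm_bounded[of x k] x(2) by simp
      moreover have "p i (apply_bcontfun x) = \<psi> i x" for i by (simp add: p_def apply_bcontfun_inverse)
      ultimately show ?thesis
        using x by (intro bexI[of _ "apply_bcontfun x"]) (simp_all add: apply_bcontfun_mem_null_fun)
    qed
    with exhaustive_imp_not_uniformly_positive[OF exh[OF seq] half_gt_zero[OF d(1)] K(1)]
    show False by blast
  qed
qed

lemma (in pathological_blocks) grothendieck_cover_ideal: "grothendieck_ideal cover_ideal"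
proof (rule exhaustive_imp_grothendieck_ideal[OF omega_ideal_cover_ideal])
  fix R p assume seq: "bdd_functional_seq cover_ideal R p"
  then interpret bdd_functional_seq cover_ideal R p .
  show exhaustive
    unfolding exhaustive_def using uniformly_exhaustive[OF seq] by blast
qed

lemma pathological_blocks_exist: "\<exists>fib S. pathological_blocks fib S"
proof -
  define T :: "(nat \<times> nat set) set" where "T = (SIGMA n:UNIV. {a. a \<subseteq> {..<2 * n} \<and> card a = n})"
  have fin: "finite {a. a \<subseteq> {..<2 * n} \<and> card a = n}" for n :: nat
    by (rule finite_subset[of _ "Pow {..<2 * n}"]) auto
  have "countable T"
    unfolding T_def by (intro countable_SIGMA countableI_type countable_finite[OF fin])
  moreover have "infinite T"
  proof
    assume "finite T"
    moreover have "n \<in> fst ` T" for n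
      by (rule image_eqI[of _ _ "(n, {..<n})"]) (auto simp: T_def)
    then have "fst ` T = UNIV" by blast
    ultimately show False by (metis finite_imageI infinite_UNIV_nat)
  qed
  ultimately obtain h :: "nat \<Rightarrow> nat \<times> nat set" where h: "bij_betw h UNIV T"
    using bij_betw_from_nat_into by blast
  then have hT: "h k \<in> T" for k by (auto simp: bij_betw_def)
  have "pathological_blocks (\<lambda>k. fst (h k)) (\<lambda>k. snd (h k))"
  proof
    show "finite ((\<lambda>k. fst (h k)) -` {n})" for n
    proof (rule finite_imageD)
      have "h k \<in> {n} \<times> {a. a \<subseteq> {..<2 * n} \<and> card a = n}" if "fst (h k) = n" for k
        using hT[of k] that by (auto simp: T_def)
      then have "h ` ((\<lambda>k. fst (h k)) -` {n}) \<subseteq> {n} \<times> {a. a \<subseteq> {..<2 * n} \<and> card a = n}"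
        by blast
      then show "finite (h ` ((\<lambda>k. fst (h k)) -` {n}))"
        by (rule finite_subset) (intro finite_cartesian_product fin finite.intros)
      show "inj_on h ((\<lambda>k. fst (h k)) -` {n})" using h unfolding bij_betw_def by (blast intro: inj_on_subset)
    qed
    show "snd (h k) \<subseteq> {..<2 * fst (h k)}" "card (snd (h k)) = fst (h k)" for k
      using hT[of k] by (auto simp: T_def)
    show "\<exists>k. fst (h k) = n \<and> snd (h k) = a" if "a \<subseteq> {..<2 * n}" "card a = n" for n a
    proof -
      have "(n, a) \<in> range h" using h that by (auto simp: bij_betw_def T_def)
      then show ?thesis by (metis fst_conv imageE snd_conv)
    qed
  qed
  then show ?thesis by blast
qed

text \<open>For the ideal of finite sets the coordinate functionals are weak* null, but the functional on
  the dual that adds up the values at the unit vectors is \<open>1\<close> on each of them.\<close>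

lemma not_grothendieck_finite_sets: "\<not> grothendieck_ideal {A :: nat set. finite A}"
proof
  let ?J = "{A :: nat set. finite A}"
  let ?X = "c0_ideal ?J"
  assume "grothendieck_ideal ?J"
  then have G: "grothendieck_on ?X" by (simp add: grothendieck_ideal_def)
  have J: "omega_ideal ?J" by (auto simp: omega_ideal_def intro: finite_subset)
  have X: "subspace ?X" by (rule subspace_c0_ideal[OF J])
  define u where "u k = Bcontfun (indicator {k} :: nat \<Rightarrow> real)" for k :: nat
  have ind: "indicator {k} \<in> null_fun ?J" for k :: nat by (simp add: null_fun_indicator[OF J])
  have u: "u k \<in> ?X" "apply_bcontfun (u k) = indicator {k}" for k
    unfolding u_def using Bcontfun_mem_c0_ideal[OF ind] apply_Bcontfun_null_fun[OF ind] by auto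
  define \<phi> where "\<phi> n x = (if x \<in> ?X then apply_bcontfun x n else 0)" for n x
  have \<phi>: "\<phi> n \<in> dual_on ?X" for n
  proof -
    have "\<bar>apply_bcontfun x n\<bar> \<le> 1 * norm x" for x :: "nat \<Rightarrow>\<^sub>C real" using norm_bounded[of x n] by simp
    then show ?thesis
      unfolding dual_on_def \<phi>_def
      using subspace_add[OF X] subspace_scale[OF X] by (auto intro!: exI[of _ 1])
  qed
  have null: "weak_star_null_on ?X \<phi>"
    unfolding weak_star_null_on_def
  proof
    fix x assume x: "x \<in> ?X"
    have "(\<lambda>n. apply_bcontfun x n) \<longlonglongrightarrow> 0"
    proof (rule ccontr)
      assume "\<not> ?thesis"
      then obtain d where "d > 0" "infinite {k. d \<le> \<bar>apply_bcontfun x k\<bar>}" by (rule not_tendsto_zero_real)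
      then show False using x by (auto simp: c0_ideal_def)
    qed
    then show "(\<lambda>n. \<phi> n x) \<longlonglongrightarrow> 0" using x by (simp add: \<phi>_def)
  qed
  have sum_le: "(\<Sum>k<N. \<bar>f (u k)\<bar>) \<le> dual_norm_on ?X f" if f: "f \<in> dual_on ?X" for f N
  proof -
    interpret bdd_functional ?J "dual_norm_on ?X f" "\<lambda>g. f (Bcontfun g)"
      by (rule dual_on_c0_ideal_bdd_functional[OF J f dual_norm_on_bound[OF X f] dual_norm_on_nonneg[OF X f]])
    define g where "g k = (if k < N then sgn (f (u k)) else 0)" for k
    have g_mem: "g \<in> null_fun ?J"
      by (rule null_fun_support[OF J, of "{..<N}" _ 1]) (auto simp: g_def sgn_if)
    have "f (Bcontfun g) = (\<Sum>k\<in>{..<N}. g k * f (Bcontfun (indicator {k})))"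
      by (rule finite_support) (auto simp: g_def)
    also have "\<dots> = (\<Sum>k<N. \<bar>f (u k)\<bar>)"
      by (intro sum.cong refl) (simp add: g_def u_def[symmetric] abs_sgn mult.commute)
    finally have "(\<Sum>k<N. \<bar>f (u k)\<bar>) \<le> \<bar>f (Bcontfun g)\<bar>" by simp
    also have "\<dots> \<le> dual_norm_on ?X f * 1" by (rule bound[OF g_mem]) (simp add: g_def sgn_if)
    finally show ?thesis by simp
  qed
  have summable: "summable (\<lambda>k. \<bar>f (u k)\<bar>)" if f: "f \<in> dual_on ?X" for f
    by (rule summableI_nonneg_bounded[OF _ sum_le[OF f]]) simp
  define \<Phi> where "\<Phi> f = (if f \<in> dual_on ?X then \<Sum>k. f (u k) else 0)" for f
  have "\<Phi> \<in> bidual_on ?X"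
    unfolding bidual_on_def
  proof (intro CollectI conjI ballI allI impI)
    fix f g assume f: "f \<in> dual_on ?X" and g: "g \<in> dual_on ?X"
    have "(\<lambda>x. f x + 1 * g x) \<in> dual_on ?X" by (rule dual_on_linear_combination[OF f g])
    then show "\<Phi> (\<lambda>x. f x + g x) = \<Phi> f + \<Phi> g"
      using f g suminf_add[OF summable_rabs_cancel[OF summable[OF f]] summable_rabs_cancel[OF summable[OF g]]]
      by (simp add: \<Phi>_def)
  next
    fix f c assume f: "f \<in> dual_on ?X"
    show "\<Phi> (\<lambda>x. c * f x) = c * \<Phi> f"
      using f dual_on_scaled[OF f, of c] suminf_mult[OF summable_rabs_cancel[OF summable[OF f]], of c]
      by (simp add: \<Phi>_def)
  next
    have "\<bar>\<Phi> f\<bar> \<le> 1 * dual_norm_on ?X f" if f: "f \<in> dual_on ?X" for f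
    proof -
      have "\<bar>\<Phi> f\<bar> \<le> (\<Sum>k. \<bar>f (u k)\<bar>)"
        using f summable_rabs[OF summable[OF f]] by (simp add: \<Phi>_def)
      also have "\<dots> \<le> dual_norm_on ?X f" by (rule suminf_le_const[OF summable[OF f] sum_le[OF f]])
      finally show ?thesis by simp
    qed
    then show "\<exists>K. \<forall>f\<in>dual_on ?X. \<bar>\<Phi> f\<bar> \<le> K * dual_norm_on ?X f" by blast
  qed (simp add: \<Phi>_def)
  moreover have "\<Phi> (\<phi> n) = 1" for n
  proof -
    have "\<phi> n (u k) = (if k = n then 1 else 0)" for k
      using u by (auto simp: \<phi>_def indicator_def)
    then have "(\<Sum>k. \<phi> n (u k)) = (\<Sum>k\<in>{n}. \<phi> n (u k))" by (intro suminf_finite) auto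
    then show ?thesis using \<phi> u by (simp add: \<Phi>_def \<phi>_def indicator_def)
  qed
  ultimately have "(\<lambda>n :: nat. 1 :: real) \<longlonglongrightarrow> 0"
    using G \<phi> null unfolding grothendieck_on_def weakly_null_dual_on_def by fastforce
  then show False by (simp add: LIMSEQ_const_iff)
qed

theorem corollary2p15:
  shows "(\<exists>I J :: nat set set. omega_ideal I \<and> omega_ideal J \<and> katetov_le I J \<and>
            grothendieck_ideal J \<and> \<not> grothendieck_ideal I) \<and>
         (\<exists>I J :: nat set set. omega_ideal I \<and> omega_ideal J \<and> rudin_keisler_le I J \<and>
            grothendieck_ideal J \<and> \<not> grothendieck_ideal I)"
proof -
  obtain fib S where "pathological_blocks fib S" using pathological_blocks_exist by blast
  then interpret pathological_blocks fib S .
  let ?I = "{A :: nat set. finite A}"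
  have "omega_ideal ?I" by (auto simp: omega_ideal_def intro: finite_subset)
  moreover have RK: "rudin_keisler_le ?I cover_ideal"
    unfolding rudin_keisler_le_def by (intro exI[of _ fib] allI) (simp only: fib_vimage_cover_ideal mem_Collect_eq)
  moreover from RK have "katetov_le ?I cover_ideal"
    unfolding rudin_keisler_le_def katetov_le_def by blast
  ultimately show ?thesis
    using omega_ideal_cover_ideal grothendieck_cover_ideal not_grothendieck_finite_sets
    by (intro conjI exI[of _ ?I] exI[of _ cover_ideal])
qed

end
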